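(* Let $f\in\mathcal{F}_p^0$ for some $p>0$. Then $$\lim_{t\to+\infty}\frac{\mathring{T}^t_\ast\mu_f}{\mu_f(\mathring{I}^t)}=\delta_0 ,$$ where $\delta_0$ denotes the point mass at $0$ and the convergence is in the weak sense. Moreover, $$\lim_{t\to+\infty}\frac{\mu_f(\mathring{I}^{t+1})}{\mu_f(\mathring{I}^t)}=1 .$$
   Context: Fix $0<\gamma<1$. Let $I=[0,1)$, let $m$ be Lebesgue measure on $I$, and let $T:I\to I$ be given by $T(x)=x+2^\gamma x^{\gamma+1}$ for $x\in[0,\tfrac12)$ and $T(x)=2x-1$ for $x\in[\tfrac12,1)$. Let $T_L$ be the left branch of $T$ (its restriction to $[0,\tfrac12)$, extended by its formula) and $a_n=T_L^{-n}(\tfrac12)$, so $a_0=\tfrac12$ and $a_n\downarrow 0$. Let $\mathcal{P}=\{J_L,J_R\}$ with $J_L=[0,\tfrac12)$, $J_R=[\tfrac12,1)$, and $\mathcal{J}=\{J_n\}_{n\geq0}$ with $J_0=J_R$ and $J_n=[a_n,a_{n-1})$ for $n\geq1$. For $t\geq0$ let $\mathcal{J}^{(t)}=\mathcal{J}\vee\bigvee_{i=0}^tT^{-i}(\mathcal{P})$, where $\vee$ denotes the common refinement of partitions (non-empty intersections). The hole $H$ is a fixed, arbitrary element of $\mathcal{J}^{(\ell_H)}$, where $\ell_H\geq0$ is an arbitrary integer. For $t\geq0$ let $\mathring{I}^t=\bigcap_{i=0}^tT^{-i}(I\setminus H)$, and $\mathring{T}^t=T^t|_{\mathring{I}^t}$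 for $t\ge 1$. The push forward of a measure $\mu$ is $\mathring{T}^t_\ast\mu(A)=\mu(\mathring{I}^t\cap T^{-t}(A))$. For $f\in L^1(m)$, $\mu_f$ is the measure with density $f$ with respect to $m$, and $|\cdot|_1$ is the $L^1(m)$ norm. Let $C^0(\mathcal{J}^{(\ell_H)})$ be the set of functions defined on the interior $(0,1)$ of $I$ and continuous on each element of $\mathcal{J}^{(\ell_H)}$. For $f\in C^0(\mathcal{J}^{(\ell_H)})$, $f\geq0$, $p>0$ and $J\in\mathcal{J}^{(\ell_H)}$, let $H^p_J(f)=0$ if $f\equiv0$ on $J$; $H^p_J(f)=+\infty$ if $f(x)=0<f(y)$ for some $x,y\in J$; and $H^p_J(f)=\sup_{x\neq y\in J}\frac{\log f(x)-\log f(y)}{|x-y|^p}$ if $f>0$ on $J$. Let $\|f\|_p=\sup_{J\in\mathcal{J}^{(\ell_H)}}H^p_J(f)$, $$\mathcal{F}_p=\{f\in C^0(\mathcal{J}^{(\ell_H)}) : f\geq0,\ |f|_1=1,\ \|f\|_p<+\infty\},$$ and let $\mathcal{F}_p^0$ be the set of $f\in\mathcal{F}_p$ for which there exist $x_0\in(0,1)$ and $\alpha\in[0,1)$ with $0<\inf_{x\in(0,x_0)}x^\alpha f(x)\leq\sup_{x\in(0,1)}x^\alpha f(x)<+\infty$. *)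

theory Defs
  imports "HOL-Probability.Probability"
begin

section \<open>The map and the partitions\<close>

abbreviation space_I :: "real set" where
  "space_I \<equiv> {0..<1}"

definition leb_I :: "real measure" where
  "leb_I = restrict_space lborel space_I"

text \<open>The map is given by its formula on all of \<^typ>\<open>real\<close>; only its restriction to the
  invariant set \<^term>\<open>space_I\<close> is ever used.\<close>

definition T_left :: "real \<Rightarrow> real \<Rightarrow> real" where
  "T_left \<gamma> x = x + 2 powr \<gamma> * x powr (\<gamma> + 1)"

definition T_map :: "real \<Rightarrow> real \<Rightarrow> real" where
  "T_map \<gamma> x = (if x < 1/2 then T_left \<gamma> x else 2 * x - 1)"

text \<open>The left branch, extended by its formula to the closed interval \<open>[0, 1/2]\<close>, is a
  bijection onto \<open>[0, 1]\<close>; \<open>a_seq \<gamma> n\<close> is the \<open>n\<close>-fold preimage of \<open>1/2\<close> under it.\<close>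

definition a_seq :: "real \<Rightarrow> nat \<Rightarrow> real" where
  "a_seq \<gamma> n = (inv_into {0..1/2} (T_left \<gamma>) ^^ n) (1/2)"

definition part_P :: "real set set" where
  "part_P = {{0..<1/2}, {1/2..<1}}"

definition part_J :: "real \<Rightarrow> real set set" where
  "part_J \<gamma> = insert {1/2..<1} {{a_seq \<gamma> n..<a_seq \<gamma> (n - 1)} |n. n \<ge> 1}"

definition pullback_part :: "real \<Rightarrow> nat \<Rightarrow> real set set \<Rightarrow> real set set" where
  "pullback_part \<gamma> i \<P> = (\<lambda>A. (T_map \<gamma> ^^ i) -` A \<inter> space_I) ` \<P>"

definition part_Jt :: "real \<Rightarrow> nat \<Rightarrow> real set set" where
  "part_Jt \<gamma> t =
     common_refinement (insert (part_J \<gamma>) ((\<lambda>i. pullback_part \<gamma> i part_P) ` {..t}))"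

section \<open>The open system\<close>

definition survivors :: "real \<Rightarrow> real set \<Rightarrow> nat \<Rightarrow> real set" where
  "survivors \<gamma> H t = (\<Inter>i\<in>{..t}. (T_map \<gamma> ^^ i) -` (space_I - H) \<inter> space_I)"

text \<open>\<open>open_push \<gamma> H t \<mu>\<close> assigns \<open>\<mu> (survivors \<gamma> H t \<inter> T\<^sup>-\<^sup>t A)\<close> to each Borel set \<open>A\<close> of \<open>[0, 1)\<close>.\<close>

definition open_push :: "real \<Rightarrow> real set \<Rightarrow> nat \<Rightarrow> real measure \<Rightarrow> real measure" where
  "open_push \<gamma> H t \<mu> =
     distr (restrict_space \<mu> (survivors \<gamma> H t)) (restrict_space borel space_I) (T_map \<gamma> ^^ t)"

definition mu_dens :: "(real \<Rightarrow> real) \<Rightarrow> real measure" where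
  "mu_dens f = density leb_I (\<lambda>x. ennreal (f x))"

definition weak_conv_on ::
  "'a::topological_space set \<Rightarrow> (nat \<Rightarrow> 'a measure) \<Rightarrow> 'a measure \<Rightarrow> bool" where
  "weak_conv_on X M N \<longleftrightarrow>
     (\<forall>\<phi>::'a \<Rightarrow> real. continuous_on X \<phi> \<and> bounded (\<phi> ` X) \<longrightarrow>
        (\<lambda>t. \<integral>x. \<phi> x \<partial>M t) \<longlonglongrightarrow> (\<integral>x. \<phi> x \<partial>N))"

section \<open>The function classes\<close>

text \<open>A function on \<open>(0, 1)\<close> is represented by a total function on \<^typ>\<open>real\<close>. Its values
  outside \<open>(0, 1)\<close> are irrelevant: the elements of \<open>part_Jt \<gamma> l\<close> are subsets of \<open>(0, 1)\<close>,
  and \<open>{0}\<close> is a null set.\<close>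

definition C0_part :: "real \<Rightarrow> nat \<Rightarrow> (real \<Rightarrow> real) set" where
  "C0_part \<gamma> l = {f. \<forall>J\<in>part_Jt \<gamma> l. continuous_on J f}"

definition log_hoelder :: "real \<Rightarrow> real set \<Rightarrow> (real \<Rightarrow> real) \<Rightarrow> ereal" where
  "log_hoelder p J f =
     (if \<forall>x\<in>J. f x = 0 then 0
      else if \<exists>x\<in>J. \<exists>y\<in>J. f x = 0 \<and> 0 < f y then \<infinity>
      else (SUP (x, y) \<in> {(x, y). x \<in> J \<and> y \<in> J \<and> x \<noteq> y}.
              ereal ((ln (f x) - ln (f y)) / \<bar>x - y\<bar> powr p)))"

definition p_seminorm :: "real \<Rightarrow> nat \<Rightarrow> real \<Rightarrow> (real \<Rightarrow> real) \<Rightarrow> ereal" where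
  "p_seminorm \<gamma> l p f = (SUP J\<in>part_Jt \<gamma> l. log_hoelder p J f)"

definition F_class :: "real \<Rightarrow> nat \<Rightarrow> real \<Rightarrow> (real \<Rightarrow> real) set" where
  "F_class \<gamma> l p =
     {f \<in> C0_part \<gamma> l. (\<forall>x\<in>{0<..<1}. 0 \<le> f x) \<and>
        integrable leb_I f \<and> (\<integral>x. \<bar>f x\<bar> \<partial>leb_I) = 1 \<and> p_seminorm \<gamma> l p f < \<infinity>}"

definition F0_class :: "real \<Rightarrow> nat \<Rightarrow> real \<Rightarrow> (real \<Rightarrow> real) set" where
  "F0_class \<gamma> l p =
     {f \<in> F_class \<gamma> l p. \<exists>x0\<in>{0<..<1}. \<exists>\<alpha>\<in>{0..<1}.
        0 < (INF x\<in>{0<..<x0}. ereal (x powr \<alpha> * f x)) \<and>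
        (INF x\<in>{0<..<x0}. ereal (x powr \<alpha> * f x)) \<le> (SUP x\<in>{0<..<1}. ereal (x powr \<alpha> * f x)) \<and>
        (SUP x\<in>{0<..<1}. ereal (x powr \<alpha> * f x)) < \<infinity>}"

end

theory Submission
  imports Defs "HOL-Library.Sublist"
begin

text \<open>
  Write \<open>a\<^sub>n\<close> for \<open>a_seq \<gamma> n\<close>, \<open>S\<^sub>t\<close> for the measure of the points that survive up to time
  \<open>t\<close>, and \<open>R\<^sub>t\<close> for the measure of those survivors whose position at time \<open>t\<close> is at least
  \<open>a\<^sub>N\<close>, where \<open>N\<close> is fixed. Both claims follow once \<open>R\<^sub>t / S\<^sub>t \<longlonglongrightarrow> 0\<close> for every \<open>N\<close>. This says
  directly that the normalised push forwards concentrate at \<open>0\<close>, and, since a point must lie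
  away from \<open>0\<close> in order to fall into the hole at the next step, it also says that the
  proportion lost in one step tends to \<open>0\<close>.

  The density enters through \<open>c x\<^sup>-\<^sup>\<alpha> \<le> f x\<close> near \<open>0\<close> and \<open>f x \<le> C x\<^sup>-\<^sup>\<alpha>\<close>. Points
  very close to \<open>0\<close> cannot reach the hole by time \<open>t\<close>, and they alone make \<open>S\<^sub>t\<close> at least of the
  order of \<open>t powr - ((1 - \<alpha>) / \<gamma>)\<close> (\<open>survivors_measure_lower_bound\<close>). What has to be shown is that
  \<open>R\<^sub>t\<close> decays faster by a factor \<open>1 / t\<close> (\<open>away_from_0_measure_decay\<close>).

  For this upper bound replace \<open>f\<close> by \<open>C x\<^sup>-\<^sup>\<alpha>\<close> and shrink the hole to one cylinder, given by a word
  \<open>v\<close> over the alphabet of the two branches; a surviving orbit is then one whose itinerary does not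
  contain \<open>v\<close> as a block of consecutive letters. The mass transported along a word \<open>w\<close> to an
  interval \<open>[c, d)\<close> is \<open>G (h\<^sub>w d) - G (h\<^sub>w c)\<close>, where \<open>h\<^sub>w\<close> is the inverse branch of \<open>w\<close> and \<open>G\<close> an
  antiderivative of the density. All inverse branches are increasing and concave, hence so is
  \<open>G \<circ> h\<^sub>w\<close> when the density is decreasing, and its slope on \<open>[a\<^sub>N, 1]\<close> is at most its mean slope on
  the reference band \<open>[a\<^sub>N\<^sub>+\<^sub>1, a\<^sub>N)\<close>. This one-sided comparison replaces a bounded distortion
  estimate (\<open>increasing_concave_slope\<close>, \<open>band_append_right\<close>).

  Cutting each word before its last \<open>k + 1\<close> visits to \<open>[1/2, 1)\<close> turns the comparison into a renewal
  inequality \<open>x\<^sub>n \<le> b\<^sub>n + \<Sum> x\<^sub>n\<^sub>-\<^sub>1\<^sub>-\<^sub>s q\<^sub>s\<close> for the mass \<open>x\<^sub>n\<close> in the reference band at time \<open>n\<close>. The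
  sequences \<open>b\<close> and \<open>q\<close> inherit the decay of the gaps of \<open>a\<^sub>n\<close>, because polynomial decay of exponent
  larger than \<open>1\<close> is stable under convolution. The total mass of \<open>q\<close> is bounded by a multiple of the
  Lebesgue measure of the points whose first \<open>k\<close> letters avoid \<open>v\<close>, which tends to \<open>0\<close> as
  \<open>k\<close> grows (\<open>mass_avoiding_tendsto_0\<close>); so for large \<open>k\<close> the renewal inequality is defective and
  \<open>x\<close> decays like \<open>b\<close> and \<open>q\<close> (\<open>defective_renewal_polynomial_decay\<close>).
\<close>

section \<open>Sequences of polynomial decay\<close>

lemma summable_powr_shift:
  fixes \<kappa> :: real assumes "\<kappa> > 1"
  shows "summable (\<lambda>n. (real n + 1) powr - \<kappa>)"
proof -
  have "summable (\<lambda>n. real n powr - \<kappa>)"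
    using assms by (simp add: summable_real_powr_iff)
  then have "summable (\<lambda>n. real (Suc n) powr - \<kappa>)"
    by (subst summable_Suc_iff)
  then show ?thesis by (simp add: add.commute)
qed

text \<open>
  In each product one of the two indices is roughly at least half of \<open>n\<close>, so that factor already has the
  claimed size; the other factor is summable because \<open>\<kappa> > 1\<close>.
\<close>
lemma convolution_polynomial_decay:
  fixes y z :: "nat \<Rightarrow> real" and \<kappa> :: real
  assumes "\<kappa> > 1" "A \<ge> 0" "B \<ge> 0"
    and y: "\<And>n. 0 \<le> y n" "\<And>n. y n \<le> A * (real n + 1) powr - \<kappa>"
    and z: "\<And>n. 0 \<le> z n" "\<And>n. z n \<le> B * (real n + 1) powr - \<kappa>"
  obtains C where "C \<ge> 0" "\<And>n. (\<Sum>s<n. y (n - 1 - s) * z s) \<le> C * (real n + 1) powr - \<kappa>"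
proof
  define w where "w n = (real n + 1) powr - \<kappa>" for n
  define \<zeta> where "\<zeta> = (\<Sum>n. w n)"
  have sm: "summable w" unfolding w_def using summable_powr_shift[OF \<open>\<kappa> > 1\<close>] .
  have w0: "0 \<le> w n" for n by (simp add: w_def)
  have part: "(\<Sum>s<n. w s) \<le> \<zeta>" for n
    unfolding \<zeta>_def by (rule sum_le_suminf) (use sm w0 in auto)
  have "0 \<le> \<zeta>" using part[of 0] by simp
  show "0 \<le> A * B * 2 powr \<kappa> * (2 * \<zeta>)" using assms \<open>0 \<le> \<zeta>\<close> by simp
  fix n
  have summand: "w (n - 1 - s) * w s \<le> 2 powr \<kappa> * w n * (w (n - 1 - s) + w s)" if "s < n" for s
  proof -
    have half: "w m \<le> 2 powr \<kappa> * w n" if "real n + 1 \<le> 2 * (real m + 1)" for m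
    proof -
      have "w m \<le> ((real n + 1) / 2) powr - \<kappa>"
        unfolding w_def using that \<open>\<kappa> > 1\<close> by (intro powr_mono2') auto
      also have "\<dots> = 2 powr \<kappa> * w n"
        by (simp add: w_def powr_divide powr_minus field_simps)
      finally show ?thesis .
    qed
    obtain r where "n = Suc (s + r)" using \<open>s < n\<close> less_imp_Suc_add by blast
    then have "real n + 1 \<le> 2 * (real (n - 1 - s) + 1) \<or> real n + 1 \<le> 2 * (real s + 1)"
      by auto
    then consider "real n + 1 \<le> 2 * (real (n - 1 - s) + 1)" | "real n + 1 \<le> 2 * (real s + 1)"
      by blast
    then show ?thesis
    proof cases
      case 1
      have "w (n - 1 - s) * w s \<le> 2 powr \<kappa> * w n * w s"
        by (rule mult_right_mono[OF half[OF 1] w0])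
      moreover have "0 \<le> 2 powr \<kappa> * w n * w (n - 1 - s)" using w0 by simp
      ultimately show ?thesis by (simp add: distrib_left)
    next
      case 2
      have "w (n - 1 - s) * w s \<le> w (n - 1 - s) * (2 powr \<kappa> * w n)"
        by (rule mult_left_mono[OF half[OF 2] w0])
      moreover have "0 \<le> 2 powr \<kappa> * w n * w s" using w0 by simp
      ultimately show ?thesis by (simp add: distrib_left mult_ac)
    qed
  qed
  have "(\<Sum>s<n. y (n - 1 - s) * z s) \<le> (\<Sum>s<n. (A * w (n - 1 - s)) * (B * w s))"
    using y z w0 \<open>A \<ge> 0\<close> by (intro sum_mono mult_mono) (simp_all only: w_def mult_nonneg_nonneg)
  also have "\<dots> = A * B * (\<Sum>s<n. w (n - 1 - s) * w s)"
    by (simp add: sum_distrib_left mult_ac)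
  also have "\<dots> \<le> A * B * (\<Sum>s<n. 2 powr \<kappa> * w n * (w (n - 1 - s) + w s))"
    using assms by (intro mult_left_mono sum_mono summand) auto
  also have "\<dots> = A * B * (2 powr \<kappa> * w n * ((\<Sum>s<n. w (n - 1 - s)) + (\<Sum>s<n. w s)))"
    by (simp add: sum_distrib_left[symmetric] sum.distrib[symmetric])
  also have "(\<Sum>s<n. w (n - 1 - s)) = (\<Sum>s<n. w s)"
    using sum.nat_diff_reindex[of w n] by simp
  also have "A * B * (2 powr \<kappa> * w n * ((\<Sum>s<n. w s) + (\<Sum>s<n. w s)))
      \<le> A * B * (2 powr \<kappa> * w n * (\<zeta> + \<zeta>))"
    using assms w0 part by (intro mult_left_mono add_mono) auto
  finally show "(\<Sum>s<n. y (n - 1 - s) * z s)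
      \<le> A * B * 2 powr \<kappa> * (2 * \<zeta>) * (real n + 1) powr - \<kappa>"
    by (simp add: w_def mult_ac)
qed

text \<open>
  A kernel of total mass \<open>\<rho> < 1\<close> contracts the weighted supremum norm, provided that the weight
  varies slowly. The translated weight \<open>(n + K + 1) powr - \<kappa>\<close> does when \<open>K\<close> is large. Shifts \<open>s\<close> below
  \<open>\<theta> (n + K + 1)\<close> change it by a factor close to \<open>1\<close>, and for larger shifts the decay of \<open>q\<close> pays.
\<close>
lemma defective_renewal_polynomial_decay:
  fixes x b q :: "nat \<Rightarrow> real" and \<kappa> \<rho> :: real
  assumes "\<kappa> > 1" "\<rho> < 1" "B \<ge> 0" "D \<ge> 0"
    and q: "\<And>n. 0 \<le> q n" "\<And>n. q n \<le> B * (real n + 1) powr - \<kappa>" "\<And>n. (\<Sum>s<n. q s) \<le> \<rho>"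
    and b: "\<And>n. b n \<le> D * (real n + 1) powr - \<kappa>"
    and x: "\<And>n. x n \<le> b n + (\<Sum>s<n. x (n - 1 - s) * q s)"
  obtains C where "C \<ge> 0" "\<And>n. x n \<le> C * (real n + 1) powr - \<kappa>"
proof -
  have "0 \<le> \<rho>" using q(3)[of 0] by simp
  define \<eta> where "\<eta> = (1 - \<rho>) / 4"
  have "\<eta> > 0" using \<open>\<rho> < 1\<close> by (simp add: \<eta>_def)
  \<comment> \<open>The total mass budget is \<open>\<rho> + 4 * \<eta> = 1\<close>: one \<open>\<eta>\<close> for small shifts, one for large shifts,
    and two for the inhomogeneous term \<open>b\<close>.\<close>
  have "((\<lambda>\<theta>. \<rho> * (1 - \<theta>) powr - \<kappa>) \<longlongrightarrow> \<rho> * (1 - 0) powr - \<kappa>) (at_right 0)"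
    by (intro tendsto_intros) auto
  then have "eventually (\<lambda>\<theta>. \<rho> * (1 - \<theta>) powr - \<kappa> < \<rho> + \<eta>) (at_right 0)"
    using \<open>\<eta> > 0\<close> by (intro order_tendstoD) auto
  moreover have "eventually (\<lambda>\<theta>::real. 0 < \<theta> \<and> \<theta> < 1) (at_right 0)"
    using eventually_at_right_real[of 0 "1::real"] by (auto elim: eventually_mono)
  ultimately have "eventually (\<lambda>\<theta>. \<rho> * (1 - \<theta>) powr - \<kappa> < \<rho> + \<eta> \<and> 0 < \<theta> \<and> \<theta> < 1) (at_right 0)"
    by (rule eventually_conj)
  then obtain \<theta> where \<theta>: "\<rho> * (1 - \<theta>) powr - \<kappa> < \<rho> + \<eta>" "0 < \<theta>" "\<theta> < 1"
    using eventually_happens'[OF trivial_limit_at_right_real] by blast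
  define w where "w n = (real n + 1) powr - \<kappa>" for n
  have sm: "summable w" unfolding w_def using summable_powr_shift[OF \<open>\<kappa> > 1\<close>] .
  have w0: "0 \<le> w n" for n by (simp add: w_def)
  have "(\<lambda>K. B * \<theta> powr - \<kappa> * (\<Sum>j. w (j + K))) \<longlonglongrightarrow> B * \<theta> powr - \<kappa> * 0"
    by (intro tendsto_mult tendsto_const suminf_exist_split2 sm)
  then have "eventually (\<lambda>K. B * \<theta> powr - \<kappa> * (\<Sum>j. w (j + K)) < \<eta>) sequentially"
    using \<open>\<eta> > 0\<close> by (intro order_tendstoD) auto
  then obtain K where K: "B * \<theta> powr - \<kappa> * (\<Sum>j. w (j + K)) < \<eta>"
    by (auto simp: eventually_sequentially)
  have smK: "summable (\<lambda>j. w (j + K))" using sm by (subst summable_iff_shift)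
  \<comment> \<open>The weight \<open>W\<close> is so flat near the origin that convolution with \<open>q\<close> stays a contraction
    in the norm \<open>sup |x n| / W n\<close>.\<close>
  define W where "W n = (real n + real K + 1) powr - \<kappa>" for n
  have W0: "0 < W n" for n by (simp add: W_def)
  have contraction: "(\<Sum>s<n. W (n - 1 - s) * q s) \<le> (\<rho> + 2 * \<eta>) * W n" for n
  proof -
    have summand: "W (n - 1 - s) * q s
        \<le> (1 - \<theta>) powr - \<kappa> * W n * q s + B * \<theta> powr - \<kappa> * W n * W (n - 1 - s)" if "s < n" for s
    proof (cases "real s + 1 \<le> \<theta> * (real n + real K + 1)")
      case True
      have pos: "0 < (1 - \<theta>) * (real n + real K + 1)" using \<theta> by (intro mult_pos_pos) auto
      have "W (n - 1 - s) \<le> ((1 - \<theta>) * (real n + real K + 1)) powr - \<kappa>"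
        unfolding W_def using that True \<open>\<kappa> > 1\<close>
        by (intro powr_mono2' pos) (auto simp: of_nat_diff algebra_simps)
      also have "\<dots> = (1 - \<theta>) powr - \<kappa> * W n"
        using \<theta> by (simp add: W_def powr_mult)
      finally have "W (n - 1 - s) * q s \<le> (1 - \<theta>) powr - \<kappa> * W n * q s"
        by (rule mult_right_mono) (rule q)
      moreover have "0 \<le> B * \<theta> powr - \<kappa> * W n * W (n - 1 - s)"
        using \<open>B \<ge> 0\<close> W0 by (simp add: less_imp_le)
      ultimately show ?thesis by linarith
    next
      case False
      have "q s \<le> B * (real s + 1) powr - \<kappa>" by (rule q)
      also have "\<dots> \<le> B * (\<theta> * (real n + real K + 1)) powr - \<kappa>"
        using False \<open>\<kappa> > 1\<close> \<theta> \<open>B \<ge> 0\<close> by (intro mult_left_mono powr_mono2') auto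
      also have "\<dots> = B * \<theta> powr - \<kappa> * W n" using \<theta> by (simp add: W_def powr_mult)
      finally have "W (n - 1 - s) * q s \<le> W (n - 1 - s) * (B * \<theta> powr - \<kappa> * W n)"
        using W0 by (intro mult_left_mono) (auto simp: less_imp_le)
      moreover have "0 \<le> (1 - \<theta>) powr - \<kappa> * W n * q s"
        using q W0 by (simp add: less_imp_le)
      ultimately show ?thesis by (simp add: mult_ac)
    qed
    have "(\<Sum>s<n. W (n - 1 - s) * q s)
        \<le> (\<Sum>s<n. (1 - \<theta>) powr - \<kappa> * W n * q s + B * \<theta> powr - \<kappa> * W n * W (n - 1 - s))"
      by (intro sum_mono summand) auto
    also have "\<dots> = (1 - \<theta>) powr - \<kappa> * W n * (\<Sum>s<n. q s)
        + B * \<theta> powr - \<kappa> * W n * (\<Sum>s<n. W (n - 1 - s))"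
      by (simp add: sum.distrib sum_distrib_left)
    also have "(\<Sum>s<n. W (n - 1 - s)) = (\<Sum>s<n. w (s + K))"
      using sum.nat_diff_reindex[of W n] by (simp add: W_def w_def add_ac)
    also have "(1 - \<theta>) powr - \<kappa> * W n * (\<Sum>s<n. q s) \<le> (1 - \<theta>) powr - \<kappa> * W n * \<rho>"
      using q W0 by (intro mult_left_mono) (auto simp: less_imp_le)
    also have "\<dots> \<le> (\<rho> + \<eta>) * W n"
      using mult_right_mono[OF less_imp_le[OF \<theta>(1)] less_imp_le[OF W0[of n]]] by (simp add: mult_ac)
    also have "B * \<theta> powr - \<kappa> * W n * (\<Sum>s<n. w (s + K)) \<le> B * \<theta> powr - \<kappa> * W n * (\<Sum>j. w (j + K))"
      using W0 \<open>B \<ge> 0\<close> w0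
      by (intro mult_left_mono sum_le_suminf smK) (auto simp: less_imp_le)
    also have "\<dots> \<le> \<eta> * W n"
      using mult_right_mono[OF less_imp_le[OF K] less_imp_le[OF W0[of n]]] by (simp add: mult_ac)
    finally show ?thesis by (simp add: algebra_simps)
  qed
  define C where "C = D * (real K + 1) powr \<kappa> / (2 * \<eta>)"
  have "C \<ge> 0" using \<open>D \<ge> 0\<close> \<open>\<eta> > 0\<close> by (simp add: C_def)
  have bW: "b n \<le> 2 * \<eta> * C * W n" for n
  proof -
    have "(real n + 1) powr - \<kappa> \<le> ((real n + real K + 1) / (real K + 1)) powr - \<kappa>"
      using \<open>\<kappa> > 1\<close> by (intro powr_mono2') (auto simp: field_simps)
    also have "\<dots> = (real K + 1) powr \<kappa> * W n"
      by (simp add: W_def powr_divide powr_minus field_simps)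
    finally have "D * (real n + 1) powr - \<kappa> \<le> D * ((real K + 1) powr \<kappa> * W n)"
      using \<open>D \<ge> 0\<close> by (rule mult_left_mono)
    with b[of n] show ?thesis using \<open>\<eta> > 0\<close> by (simp add: C_def)
  qed
  have "x n \<le> C * W n" for n
  proof (induction n rule: less_induct)
    case (less n)
    have "x n \<le> b n + (\<Sum>s<n. x (n - 1 - s) * q s)" by (rule x)
    also have "(\<Sum>s<n. x (n - 1 - s) * q s) \<le> (\<Sum>s<n. (C * W (n - 1 - s)) * q s)"
      by (intro sum_mono mult_right_mono less q) auto
    also have "\<dots> = C * (\<Sum>s<n. W (n - 1 - s) * q s)"
      by (simp add: sum_distrib_left mult_ac)
    also have "\<dots> \<le> C * ((\<rho> + 2 * \<eta>) * W n)"
      by (rule mult_left_mono[OF contraction \<open>C \<ge> 0\<close>])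
    also have "b n \<le> 2 * \<eta> * C * W n" by (rule bW)
    also have "2 * \<eta> * C * W n + C * ((\<rho> + 2 * \<eta>) * W n) = (\<rho> + 4 * \<eta>) * (C * W n)"
      by (simp add: algebra_simps)
    also have "\<rho> + 4 * \<eta> = 1" by (simp add: \<eta>_def field_simps)
    finally show ?case by simp
  qed
  moreover have "C * W n \<le> C * (real n + 1) powr - \<kappa>" for n
    unfolding W_def using \<open>\<kappa> > 1\<close> \<open>C \<ge> 0\<close> by (intro mult_left_mono powr_mono2') auto
  ultimately show ?thesis using that[OF \<open>C \<ge> 0\<close>] order_trans by blast
qed

section \<open>Increasing concave functions\<close>

text \<open>
  The point \<open>0\<close> is left out since the functions of interest can have infinite slope there; this
  way concavity can be checked with derivatives.
\<close>
definition increasing_concave :: "(real \<Rightarrow> real) \<Rightarrow> bool" where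
  "increasing_concave G \<longleftrightarrow> mono_on {0<..1} G \<and> concave_on {0<..1} G"

lemma increasing_concaveD:
  "increasing_concave G \<Longrightarrow> 0 < x \<Longrightarrow> x \<le> y \<Longrightarrow> y \<le> 1 \<Longrightarrow> G x \<le> G y"
  unfolding increasing_concave_def by (auto elim: mono_onD)

text \<open>
  Mean slopes of a concave function decrease from left to right. Applied to the antiderivative of a
  density that has been transported along a word, this bounds the density on \<open>[u, v]\<close> by its mean
  over any interval \<open>[x, y]\<close> further left.
\<close>
lemma increasing_concave_slope:
  assumes G: "increasing_concave G" and "0 < x" "x < y" "y \<le> u" "u \<le> v" "v \<le> 1"
  shows "G v - G u \<le> (v - u) / (y - x) * (G y - G x)"
proof (cases "u = v")
  case False
  then have "u < v" using assms by simp
  have cvx: "convex_on {0<..1} (\<lambda>x. - G x)"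
    using G by (simp add: increasing_concave_def concave_on_def)
  have 1: "(- G x - - G y) / (x - y) \<le> (- G y - - G v) / (y - v)"
    using convex_on_slope_le[OF cvx, of x v y] assms \<open>u < v\<close> by fastforce
  have 2: "(- G y - - G v) / (y - v) \<le> (- G u - - G v) / (u - v)"
  proof (cases "y = u")
    case False
    then show ?thesis using convex_on_slope_le(2)[OF cvx, of y v u] assms \<open>u < v\<close> by fastforce
  qed simp
  have "(G v - G u) / (v - u) = - ((- G u - - G v) / (u - v))"
    using \<open>u < v\<close> by (simp add: field_simps)
  also have "\<dots> \<le> - ((- G x - - G y) / (x - y))"
    using 1 2 by linarith
  also have "\<dots> = (G y - G x) / (y - x)"
    using \<open>x < y\<close> by (simp add: field_simps)
  finally have "(G v - G u) / (v - u) * (v - u) \<le> (G y - G x) / (y - x) * (v - u)"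
    using \<open>u < v\<close> by (intro mult_right_mono) auto
  then show ?thesis using \<open>u < v\<close> by (simp add: mult_ac)
qed simp

lemma increasing_concave_compose:
  assumes G: "increasing_concave G" and k: "increasing_concave k"
    and maps: "\<And>x. 0 < x \<Longrightarrow> x \<le> 1 \<Longrightarrow> 0 < k x \<and> k x \<le> 1"
  shows "increasing_concave (\<lambda>x. G (k x))"
  unfolding increasing_concave_def
proof
  show "mono_on {0<..1} (\<lambda>x. G (k x))"
    by (intro mono_onI increasing_concaveD[OF G] increasing_concaveD[OF k])
      (use maps in \<open>auto\<close>)
  show "concave_on {0<..1} (\<lambda>x. G (k x))"
    unfolding concave_on_iff
  proof (intro conjI ballI allI impI)
    fix x y u v :: real
    assume *: "x \<in> {0<..1}" "y \<in> {0<..1}" "0 \<le> u" "0 \<le> v" "u + v = 1"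
    have kk: "k x \<in> {0<..1}" "k y \<in> {0<..1}" using * maps by auto
    have in1: "u * s + v * t \<in> {0<..1}" if "s \<in> {0<..1}" "t \<in> {0<..1}" for s t
      using convexD[OF convex_real_interval(6)[of 0 1] that *(3-5)] by simp
    have "u * k x + v * k y \<le> k (u * x + v * y)"
      using k * unfolding increasing_concave_def concave_on_iff by auto
    then have "G (u * k x + v * k y) \<le> G (k (u * x + v * y))"
      using in1[OF kk] in1[OF *(1,2)] maps[of "u * x + v * y"]
      by (intro increasing_concaveD[OF G]) auto
    moreover have "u * G (k x) + v * G (k y) \<le> G (u * k x + v * k y)"
      using G kk * unfolding increasing_concave_def concave_on_iff by auto
    ultimately show "u * G (k x) + v * G (k y) \<le> G (k (u *\<^sub>R x + v *\<^sub>R y))" by simp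
  qed (simp add: convex_real_interval)
qed

lemma increasing_concave_ident: "increasing_concave (\<lambda>x. x)"
  by (auto simp: increasing_concave_def concave_on_ident convex_real_interval mono_on_def)

text \<open>
  The antiderivative of the decreasing density \<open>x\<^sup>-\<^sup>\<alpha>\<close>.
\<close>
lemma increasing_concave_powr:
  assumes "0 \<le> \<alpha>" "\<alpha> < 1"
  shows "increasing_concave (\<lambda>x. x powr (1 - \<alpha>) / (1 - \<alpha>))"
  unfolding increasing_concave_def concave_on_def
proof
  show "mono_on {0<..1} (\<lambda>x. x powr (1 - \<alpha>) / (1 - \<alpha>))"
    using assms by (intro mono_onI divide_right_mono powr_mono2) auto
  show "convex_on {0<..1} (\<lambda>x. - (x powr (1 - \<alpha>) / (1 - \<alpha>)))"
  proof (rule convex_on_realI[where f' = "\<lambda>x. - (x powr - \<alpha>)"])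
    fix x :: real assume "x \<in> {0<..1}"
    then show "((\<lambda>x. - (x powr (1 - \<alpha>) / (1 - \<alpha>))) has_real_derivative - (x powr - \<alpha>)) (at x)"
      using assms by (auto intro!: derivative_eq_intros simp: divide_simps)
  next
    fix x y :: real assume "x \<in> {0<..1}" "y \<in> {0<..1}" "x \<le> y"
    then show "- (x powr - \<alpha>) \<le> - (y powr - \<alpha>)"
      using assms powr_mono2'[of "\<alpha>" x y] by (auto simp: powr_minus le_imp_inverse_le powr_mono2)
  qed (simp add: connected_iff_interval)
qed

section \<open>The left branch and the preimages of 1/2\<close>

locale intermittent_map =
  fixes \<gamma> :: real
  assumes \<gamma>_pos: "0 < \<gamma>"
begin

abbreviation T where "T \<equiv> T_map \<gamma>"
abbreviation a where "a \<equiv> a_seq \<gamma>"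
abbreviation left_inv where "left_inv \<equiv> inv_into {0..1/2} (T_left \<gamma>)"

lemma T_left_0: "T_left \<gamma> 0 = 0" and T_left_half: "T_left \<gamma> (1/2) = 1"
proof -
  show "T_left \<gamma> 0 = 0" by (simp add: T_left_def)
  have "2 powr \<gamma> * (1/2) powr (\<gamma> + 1) = (1/2::real)"
    by (simp add: powr_divide powr_add)
  then show "T_left \<gamma> (1/2) = 1" by (simp add: T_left_def)
qed

lemma T_left_strict_mono: "0 \<le> x \<Longrightarrow> x < y \<Longrightarrow> T_left \<gamma> x < T_left \<gamma> y"
  unfolding T_left_def using \<gamma>_pos by (intro add_strict_mono mult_strict_left_mono powr_less_mono2) auto

lemma T_left_cont: "continuous_on {0..1/2} (T_left \<gamma>)"
  unfolding T_left_def using \<gamma>_pos by (intro continuous_intros continuous_on_powr') auto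

lemma T_left_inj: "inj_on (T_left \<gamma>) {0..1/2}"
  by (rule inj_onI) (metis T_left_strict_mono atLeastAtMost_iff less_irrefl linorder_neqE_linordered_idom)

lemma T_left_image: "T_left \<gamma> ` {0..1/2} = {0..1}"
proof
  show "T_left \<gamma> ` {0..1/2} \<subseteq> {0..1}"
  proof (rule image_subsetI)
    fix x :: real assume "x \<in> {0..1/2}"
    then have x: "0 \<le> x" "x \<le> 1/2" by auto
    have "0 \<le> T_left \<gamma> x" using x by (simp add: T_left_def)
    moreover have "T_left \<gamma> x \<le> T_left \<gamma> (1/2)"
      using T_left_strict_mono[of x "1/2"] x by (metis less_eq_real_def)
    ultimately show "T_left \<gamma> x \<in> {0..1}" using T_left_half by simp
  qed
  show "{0..1} \<subseteq> T_left \<gamma> ` {0..1/2}"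
  proof
    fix y :: real assume "y \<in> {0..1}"
    then have "\<exists>x\<ge>0. x \<le> 1/2 \<and> T_left \<gamma> x = y"
      by (intro IVT') (auto simp: T_left_0 T_left_half[simplified] T_left_cont[simplified])
    then show "y \<in> T_left \<gamma> ` {0..1/2}" by force
  qed
qed

lemma left_inv_range: "0 \<le> y \<Longrightarrow> y \<le> 1 \<Longrightarrow> 0 \<le> left_inv y \<and> left_inv y \<le> 1/2"
  using inv_into_into[of y "T_left \<gamma>" "{0..1/2}"] T_left_image by auto

lemma T_left_left_inv: "0 \<le> y \<Longrightarrow> y \<le> 1 \<Longrightarrow> T_left \<gamma> (left_inv y) = y"
  by (rule f_inv_into_f) (auto simp: T_left_image[simplified])

lemma left_inv_T_left: "0 \<le> x \<Longrightarrow> x \<le> 1/2 \<Longrightarrow> left_inv (T_left \<gamma> x) = x"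
  by (rule inv_into_f_f[OF T_left_inj]) auto

lemma left_inv_0: "left_inv 0 = 0" and left_inv_1: "left_inv 1 = 1/2"
  using left_inv_T_left[of 0] left_inv_T_left[of "1/2"] by (auto simp: T_left_0 T_left_half[simplified])

lemma left_inv_less: "0 \<le> y \<Longrightarrow> y < z \<Longrightarrow> z \<le> 1 \<Longrightarrow> left_inv y < left_inv z"
  using T_left_strict_mono[of "left_inv z" "left_inv y"] T_left_left_inv[of y] T_left_left_inv[of z]
    left_inv_range[of z]
  by (cases "left_inv z = left_inv y") force+

lemma left_inv_le: "0 \<le> y \<Longrightarrow> y \<le> z \<Longrightarrow> z \<le> 1 \<Longrightarrow> left_inv y \<le> left_inv z"
  using left_inv_less[of y z] by (cases "y = z") auto

lemma left_inv_pos: "0 < y \<Longrightarrow> y \<le> 1 \<Longrightarrow> 0 < left_inv y"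
  using left_inv_less[of 0 y] by (simp add: left_inv_0)

lemma left_inv_less_self: "0 < y \<Longrightarrow> y \<le> 1 \<Longrightarrow> left_inv y < y"
proof -
  assume "0 < y" "y \<le> 1"
  then have "left_inv y + 2 powr \<gamma> * left_inv y powr (\<gamma> + 1) = y" "0 < left_inv y"
    using T_left_left_inv[of y] left_inv_pos[of y] by (auto simp: T_left_def)
  moreover from this(2) have "0 < 2 powr \<gamma> * left_inv y powr (\<gamma> + 1)" by simp
  ultimately show ?thesis by linarith
qed

lemma left_inv_cont: "continuous_on {0..1} left_inv"
proof -
  have "continuous_on {0..1} (the_inv_into {0..1/2} (T_left \<gamma>))"
    using continuous_on_inv_into[OF T_left_cont _ T_left_inj] T_left_image by simp
  moreover have "the_inv_into {0..1/2} (T_left \<gamma>) y = left_inv y" if "y \<in> {0..1}" for y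
    using that T_left_left_inv[of y] left_inv_range[of y] by (intro the_inv_into_f_eq[OF T_left_inj]) auto
  ultimately show ?thesis by (rule continuous_on_eq)
qed

lemma left_inv_compare:
  assumes "0 \<le> x" "x \<le> 1/2" "0 \<le> c" "c \<le> 1"
  shows "left_inv c \<le> x \<longleftrightarrow> c \<le> T_left \<gamma> x" "x < left_inv c \<longleftrightarrow> T_left \<gamma> x < c"
proof -
  have "T_left \<gamma> x \<in> {0..1}" using T_left_image assms(1,2) by auto
  then have *: "left_inv c \<le> x \<longleftrightarrow> c \<le> T_left \<gamma> x"
    using left_inv_le[of c "T_left \<gamma> x"] left_inv_less[of "T_left \<gamma> x" c] left_inv_T_left[of x] assms
    by (cases "c \<le> T_left \<gamma> x") auto
  show "left_inv c \<le> x \<longleftrightarrow> c \<le> T_left \<gamma> x" by (rule *)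
  show "x < left_inv c \<longleftrightarrow> T_left \<gamma> x < c" using * by linarith
qed

lemma T_left_convex: "convex_on {0<..1/2} (T_left \<gamma>)"
proof -
  have "convex_on {0<..} (\<lambda>x. x + 2 powr \<gamma> * x powr (\<gamma> + 1))"
    using \<gamma>_pos by (intro convex_on_add convex_on_cmul powr_convex) (auto simp: convex_on_ident convex_real_interval)
  then show ?thesis
    unfolding T_left_def by (rule convex_on_subset) (auto simp: convex_real_interval)
qed

lemma increasing_concave_left_inv: "increasing_concave left_inv"
  unfolding increasing_concave_def
proof
  show "mono_on {0<..1} left_inv"
    by (intro mono_onI left_inv_le) auto
  show "concave_on {0<..1} left_inv"
    unfolding concave_on_iff
  proof (intro conjI ballI allI impI)
    fix x y u v :: real
    assume *: "x \<in> {0<..1}" "y \<in> {0<..1}" "0 \<le> u" "0 \<le> v" "u + v = 1"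
    define s where "s = u * left_inv x + v * left_inv y"
    have l: "left_inv x \<in> {0<..1/2}" "left_inv y \<in> {0<..1/2}"
      using * left_inv_range[of x] left_inv_range[of y] left_inv_pos[of x] left_inv_pos[of y] by auto
    have s: "s \<in> {0<..1/2}"
      using convexD[OF convex_real_interval(6)[of 0 "1/2"] l *(3-5)] by (simp add: s_def)
    have "u * x + v * y \<in> {0<..1}"
      using convexD[OF convex_real_interval(6)[of 0 1] *] by simp
    moreover have "T_left \<gamma> s \<le> u * T_left \<gamma> (left_inv x) + v * T_left \<gamma> (left_inv y)"
      using T_left_convex l * unfolding convex_on_def s_def by auto
    then have "T_left \<gamma> s \<le> u * x + v * y"
      using * by (simp add: T_left_left_inv)
    moreover have "0 \<le> T_left \<gamma> s" using s T_left_image by auto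
    ultimately have "left_inv (T_left \<gamma> s) \<le> left_inv (u * x + v * y)"
      by (intro left_inv_le) auto
    then show "u * left_inv x + v * left_inv y \<le> left_inv (u *\<^sub>R x + v *\<^sub>R y)"
      using left_inv_T_left[of s] s by (simp add: s_def)
  qed (simp add: convex_real_interval)
qed

lemma a_0: "a 0 = 1/2" and a_Suc: "a (Suc n) = left_inv (a n)"
  by (simp_all add: a_seq_def)

lemma a_range: "0 < a n \<and> a n \<le> 1/2"
  by (induction n) (use left_inv_pos left_inv_range in \<open>auto simp: a_0 a_Suc\<close>)

lemma a_pos: "0 < a n" and a_le_half: "a n \<le> 1/2" and a_le_1: "a n \<le> 1"
  using a_range[of n] by auto

lemma a_Suc_less: "a (Suc n) < a n"
  using left_inv_less_self[of "a n"] a_pos a_le_1 by (simp add: a_Suc)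

lemma a_antimono: "m \<le> n \<Longrightarrow> a n \<le> a m"
  by (rule lift_Suc_antimono_le[of a]) (auto intro: less_imp_le a_Suc_less)

lemma T_left_a_Suc: "T_left \<gamma> (a (Suc n)) = a n"
  using T_left_left_inv[of "a n"] a_pos[of n] a_le_1[of n] by (simp add: a_Suc)

lemma a_gap: "a n - a (Suc n) = 2 powr \<gamma> * a (Suc n) powr (\<gamma> + 1)"
  using T_left_a_Suc[of n] by (simp add: T_left_def)

text \<open>
  The quantity \<open>z\<^sub>n = a\<^sub>n\<^sup>-\<^sup>\<gamma>\<close> grows linearly. Indeed
  \<open>z\<^sub>n = z\<^sub>n\<^sub>+\<^sub>1 (1 + x)\<^sup>-\<^sup>\<gamma>\<close> with \<open>x = 2\<^sup>\<gamma> / z\<^sub>n\<^sub>+\<^sub>1 \<le> 1\<close>, and \<open>1 - (1 + x)\<^sup>-\<^sup>\<gamma>\<close> lies between two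
  multiples of \<open>x\<close>, so \<open>z\<^sub>n\<^sub>+\<^sub>1 - z\<^sub>n\<close> lies between two positive constants.
\<close>
lemma a_polynomial_bounds:
  obtains c C where "0 < c" "0 < C"
    "\<And>n. c * (real n + 1) powr - (1 / \<gamma>) \<le> a n" "\<And>n. a n \<le> C * (real n + 1) powr - (1 / \<gamma>)"
proof -
  define z where "z n = a n powr - \<gamma>" for n
  define k where "k = \<gamma> / (2 + \<gamma>)"
  have k: "0 < k" "k \<le> 1" using \<gamma>_pos by (auto simp: k_def)
  have z0: "z 0 = 2 powr \<gamma>" by (simp add: z_def a_0 powr_minus powr_divide)
  have step: "z n + k * 2 powr \<gamma> \<le> z (Suc n) \<and> z (Suc n) \<le> z n + \<gamma> * 2 powr \<gamma>" for n
  proof -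
    define x where "x = 2 powr \<gamma> * a (Suc n) powr \<gamma>"
    have x_pos: "0 < x" using a_pos[of "Suc n"] by (simp add: x_def)
    have "x \<le> 2 powr \<gamma> * (1/2) powr \<gamma>"
      unfolding x_def using a_pos[of "Suc n"] a_le_half[of "Suc n"] \<gamma>_pos
      by (intro mult_left_mono powr_mono2) auto
    then have x_le: "x \<le> 1" by (simp add: powr_divide)
    have "a n = a (Suc n) * (1 + x)"
      using a_gap[of n] a_pos[of "Suc n"] by (simp add: x_def powr_add algebra_simps)
    then have zn: "z n = z (Suc n) * (1 + x) powr - \<gamma>"
      using a_pos[of "Suc n"] x_pos by (simp add: z_def powr_mult)
    have zx: "z (Suc n) * x = 2 powr \<gamma>"
      using a_pos[of "Suc n"] by (simp add: z_def x_def powr_minus)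
    have z_pos: "0 < z (Suc n)" using a_pos[of "Suc n"] by (simp add: z_def)
    define L where "L = ln (1 + x)"
    have pL: "(1 + x) powr - \<gamma> = exp (- (\<gamma> * L))" using x_pos by (simp add: powr_def L_def)
    have "L \<le> x" using ln_add_one_self_le_self[of x] x_pos by (simp add: L_def)
    then have "1 - \<gamma> * x \<le> 1 - \<gamma> * L" using \<gamma>_pos by simp
    also have "\<dots> \<le> exp (- (\<gamma> * L))" using exp_ge_add_one_self[of "- (\<gamma> * L)"] by simp
    finally have lower: "1 - \<gamma> * x \<le> (1 + x) powr - \<gamma>" by (simp add: pL)
    have "ln (1 / (1 + x)) \<le> 1 / (1 + x) - 1" using x_pos by (intro ln_le_minus_one) auto
    then have "x / (1 + x) \<le> L" using x_pos by (simp add: L_def ln_div field_simps)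
    moreover have "x / 2 \<le> x / (1 + x)" using x_pos x_le by (intro divide_left_mono) auto
    ultimately have "x / 2 \<le> L" by (rule order_trans[rotated])
    then have "1 + \<gamma> * (x / 2) \<le> 1 + \<gamma> * L"
      using \<gamma>_pos by (intro add_left_mono mult_left_mono) auto
    also have "\<dots> \<le> exp (\<gamma> * L)" by (rule exp_ge_add_one_self)
    finally have "exp (- (\<gamma> * L)) \<le> 1 / (1 + \<gamma> * (x / 2))"
      using \<gamma>_pos x_pos by (simp add: exp_minus inverse_eq_divide frac_le add_pos_pos)
    also have "\<dots> = 1 - \<gamma> * x / (2 + \<gamma> * x)"
    proof -
      have "1 / (1 + t / 2) = 1 - t / (2 + t)" if "0 < t" for t :: real
        using that by (simp add: divide_simps)
      from this[of "\<gamma> * x"] show ?thesis using \<gamma>_pos x_pos by simp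
    qed
    also have "\<dots> \<le> 1 - \<gamma> * x / (2 + \<gamma>)"
      using \<gamma>_pos x_pos x_le by (intro diff_left_mono divide_left_mono) (auto simp: add_pos_pos)
    finally have upper: "(1 + x) powr - \<gamma> \<le> 1 - k * x" by (simp add: pL k_def)
    have "z n \<le> z (Suc n) * (1 - k * x)"
      unfolding zn using z_pos upper by (intro mult_left_mono) auto
    then have "z n \<le> z (Suc n) - k * (z (Suc n) * x)" by (simp add: algebra_simps)
    moreover have "z (Suc n) * (1 - \<gamma> * x) \<le> z n"
      unfolding zn using z_pos lower by (intro mult_left_mono) auto
    then have "z (Suc n) - \<gamma> * (z (Suc n) * x) \<le> z n" by (simp add: algebra_simps)
    ultimately show ?thesis by (simp add: zx)
  qed
  have lin: "k * 2 powr \<gamma> * (real n + 1) \<le> z n \<and> z n \<le> (1 + \<gamma>) * 2 powr \<gamma> * (real n + 1)" for n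
  proof (induction n)
    case 0
    then show ?case using k \<gamma>_pos by (simp add: z0)
  next
    case (Suc n)
    define P :: real where "P = 2 powr \<gamma>"
    have "\<gamma> * P \<le> (1 + \<gamma>) * P" by (intro mult_right_mono) (auto simp: P_def)
    moreover have "k * P * (real (Suc n) + 1) = k * P * (real n + 1) + k * P"
      "(1 + \<gamma>) * P * (real (Suc n) + 1) = (1 + \<gamma>) * P * (real n + 1) + (1 + \<gamma>) * P"
      by (simp_all add: algebra_simps)
    ultimately show ?case using Suc step[of n] unfolding P_def by linarith
  qed
  have az: "a n = z n powr - (1 / \<gamma>)" for n
    using a_pos[of n] \<gamma>_pos by (simp add: z_def powr_powr)
  define A where "A = (1 + \<gamma>) * 2 powr \<gamma>"
  define B where "B = k * 2 powr \<gamma>"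
  have AB: "0 < A" "0 < B" using k \<gamma>_pos by (auto simp: A_def B_def)
  show ?thesis
  proof (rule that)
    show "0 < A powr - (1 / \<gamma>)" "0 < B powr - (1 / \<gamma>)" using AB by auto
    fix n
    have z_pos: "0 < z n" using a_pos[of n] by (simp add: z_def)
    have "(A * (real n + 1)) powr - (1 / \<gamma>) \<le> z n powr - (1 / \<gamma>)"
      using lin[of n] \<gamma>_pos z_pos by (intro powr_mono2') (auto simp: A_def)
    then show "A powr - (1 / \<gamma>) * (real n + 1) powr - (1 / \<gamma>) \<le> a n"
      using AB by (simp add: az powr_mult)
    have "z n powr - (1 / \<gamma>) \<le> (B * (real n + 1)) powr - (1 / \<gamma>)"
      using lin[of n] \<gamma>_pos AB by (intro powr_mono2') (auto simp: B_def mult_pos_pos)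
    then show "a n \<le> B powr - (1 / \<gamma>) * (real n + 1) powr - (1 / \<gamma>)"
      using AB by (simp add: az powr_mult)
  qed
qed

lemma a_tendsto_0: "a \<longlonglongrightarrow> 0"
proof -
  obtain C where C: "0 < C" "\<And>n. a n \<le> C * (real n + 1) powr - (1 / \<gamma>)"
    by (metis a_polynomial_bounds)
  have "filterlim (\<lambda>n. real n + 1) at_top sequentially"
    by (rule filterlim_at_top_mono[OF filterlim_real_sequentially]) auto
  then have "(\<lambda>n. C * (real n + 1) powr - (1 / \<gamma>)) \<longlonglongrightarrow> C * 0"
    using \<gamma>_pos by (intro tendsto_intros tendsto_neg_powr) auto
  then have *: "(\<lambda>n. C * (real n + 1) powr - (1 / \<gamma>)) \<longlonglongrightarrow> 0" by simp
  show ?thesis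
    by (rule tendsto_sandwich[OF _ _ tendsto_const *]) (auto simp: C less_imp_le[OF a_pos])
qed

text \<open>
  The gap between consecutive preimages of \<open>1/2\<close> has length
  \<open>2 powr \<gamma> * a (Suc n) powr (\<gamma> + 1)\<close>, and the density \<open>x\<^sup>-\<^sup>\<alpha>\<close> there is at most \<open>a (Suc n) powr - \<alpha>\<close>, so
  the upper bound for \<open>a n\<close> yields the claim.
\<close>
lemma a_powr_gap_decay:
  assumes "0 \<le> \<alpha>" "\<alpha> < 1"
  obtains D where "0 \<le> D"
    "\<And>n. a n powr (1 - \<alpha>) / (1 - \<alpha>) - a (Suc n) powr (1 - \<alpha>) / (1 - \<alpha>)
          \<le> D * (real n + 1) powr - (1 + (1 - \<alpha>) / \<gamma>)"
proof -
  obtain C where C: "0 < C" "\<And>n. a n \<le> C * (real n + 1) powr - (1 / \<gamma>)"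
    by (metis a_polynomial_bounds)
  define e where "e = \<gamma> + 1 - \<alpha>"
  have "e > 0" using assms \<gamma>_pos by (simp add: e_def)
  show ?thesis
  proof (rule that)
    show "0 \<le> 2 powr \<gamma> * C powr e" by simp
    fix n
    have "\<exists>\<xi>>a (Suc n). \<xi> < a n \<and> a n powr (1 - \<alpha>) / (1 - \<alpha>) - a (Suc n) powr (1 - \<alpha>) / (1 - \<alpha>)
        = (a n - a (Suc n)) * (\<xi> powr - \<alpha>)"
    proof (rule MVT2[OF a_Suc_less])
      fix x assume "a (Suc n) \<le> x" "x \<le> a n"
      then have "0 < x" using a_pos[of "Suc n"] by linarith
      then show "((\<lambda>x. x powr (1 - \<alpha>) / (1 - \<alpha>)) has_real_derivative x powr - \<alpha>) (at x)"
        using assms by (auto intro!: derivative_eq_intros simp: divide_simps)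
    qed
    then obtain \<xi> where \<xi>: "a (Suc n) < \<xi>" and
      eq: "a n powr (1 - \<alpha>) / (1 - \<alpha>) - a (Suc n) powr (1 - \<alpha>) / (1 - \<alpha>)
        = (a n - a (Suc n)) * (\<xi> powr - \<alpha>)" by blast
    have "\<xi> powr - \<alpha> \<le> a (Suc n) powr - \<alpha>"
      using assms \<xi> a_pos[of "Suc n"] by (intro powr_mono2') auto
    then have "(a n - a (Suc n)) * (\<xi> powr - \<alpha>) \<le> (a n - a (Suc n)) * a (Suc n) powr - \<alpha>"
      using a_Suc_less[of n] by (intro mult_left_mono) auto
    also have "\<dots> = 2 powr \<gamma> * a (Suc n) powr e"
      by (simp add: a_gap e_def powr_add[symmetric] algebra_simps)
    also have "\<dots> \<le> 2 powr \<gamma> * (C * (real n + 1) powr - (1 / \<gamma>)) powr e"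
      using a_pos[of "Suc n"] a_Suc_less[of n] C(2)[of n] \<open>e > 0\<close>
      by (intro mult_left_mono powr_mono2) auto
    also have "\<dots> = 2 powr \<gamma> * C powr e * (real n + 1) powr - (1 + (1 - \<alpha>) / \<gamma>)"
      using C(1) \<gamma>_pos by (simp add: powr_mult powr_powr e_def field_simps)
    finally show "a n powr (1 - \<alpha>) / (1 - \<alpha>) - a (Suc n) powr (1 - \<alpha>) / (1 - \<alpha>)
          \<le> 2 powr \<gamma> * C powr e * (real n + 1) powr - (1 + (1 - \<alpha>) / \<gamma>)"
      using eq by simp
  qed
qed

section \<open>Inverse branches and itineraries\<close>

definition branch_inv :: "bool \<Rightarrow> real \<Rightarrow> real" where
  "branch_inv b y = (if b then (y + 1) / 2 else left_inv y)"

text \<open>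
  The letter \<open>True\<close> stands for the right branch, and the first letter records the position at
  time \<open>0\<close>, so it is the outermost inverse branch. Appending letters at the end means following
  the orbit for a longer time.
\<close>
definition word_inv :: "bool list \<Rightarrow> real \<Rightarrow> real" where
  "word_inv w y = foldr branch_inv w y"

lemma word_inv_Nil [simp]: "word_inv [] y = y"
  and word_inv_Cons: "word_inv (b # w) y = branch_inv b (word_inv w y)"
  and word_inv_append: "word_inv (u @ w) y = word_inv u (word_inv w y)"
  by (simp_all add: word_inv_def)

lemma word_inv_replicate_left: "word_inv (replicate n False) (a m) = a (n + m)"
  by (induction n) (auto simp: word_inv_Cons branch_inv_def a_Suc)

lemma branch_inv_less: "0 \<le> y \<Longrightarrow> y < z \<Longrightarrow> z \<le> 1 \<Longrightarrow> branch_inv b y < branch_inv b z"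
  using left_inv_less by (auto simp: branch_inv_def)

lemma branch_inv_range: "0 \<le> y \<Longrightarrow> y \<le> 1 \<Longrightarrow> 0 \<le> branch_inv b y \<and> branch_inv b y \<le> 1"
  using left_inv_range[of y] by (auto simp: branch_inv_def)

lemma word_inv_range: "0 \<le> y \<Longrightarrow> y \<le> 1 \<Longrightarrow> 0 \<le> word_inv w y \<and> word_inv w y \<le> 1"
  by (induction w) (use branch_inv_range in \<open>auto simp: word_inv_Cons\<close>)

lemma word_inv_less: "0 \<le> y \<Longrightarrow> y < z \<Longrightarrow> z \<le> 1 \<Longrightarrow> word_inv w y < word_inv w z"
  by (induction w) (use branch_inv_less word_inv_range in \<open>auto simp: word_inv_Cons\<close>)

lemma word_inv_le: "0 \<le> y \<Longrightarrow> y \<le> z \<Longrightarrow> z \<le> 1 \<Longrightarrow> word_inv w y \<le> word_inv w z"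
  using word_inv_less[of y z w] by (cases "y = z") auto

lemma word_inv_pos: "0 < y \<Longrightarrow> y \<le> 1 \<Longrightarrow> 0 < word_inv w y"
  using word_inv_less[of 0 y w] word_inv_range[of 0 w] by auto

lemma word_inv_cont: "continuous_on {0..1} (word_inv w)"
proof (induction w)
  case Nil
  then show ?case by (simp add: word_inv_def continuous_on_id)
next
  case (Cons b w)
  have "continuous_on {0..1} (branch_inv b)"
    unfolding branch_inv_def by (cases b) (auto intro!: continuous_intros left_inv_cont)
  then have "continuous_on {0..1} (\<lambda>y. branch_inv b (word_inv w y))"
    by (rule continuous_on_compose2[OF _ Cons]) (use word_inv_range in auto)
  then show ?case by (simp add: word_inv_Cons[abs_def])
qed

lemma increasing_concave_branch_inv: "increasing_concave (branch_inv b)"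
proof (cases b)
  case True
  have "concave_on {0<..1} (\<lambda>y::real. (y + 1) / 2)"
    unfolding concave_on_iff by (auto simp: convex_real_interval field_simps simp flip: distrib_left)
  then show ?thesis using True
    by (auto simp: increasing_concave_def branch_inv_def[abs_def] mono_on_def)
next
  case False
  then show ?thesis using increasing_concave_left_inv by (simp add: branch_inv_def[abs_def])
qed

lemma increasing_concave_word_inv:
  assumes "increasing_concave G"
  shows "increasing_concave (\<lambda>y. G (word_inv w y))"
  using assms
proof (induction w arbitrary: G)
  case (Cons b w)
  have "0 < branch_inv b y \<and> branch_inv b y \<le> 1" if "0 < y" "y \<le> 1" for y
    using that branch_inv_range[of y b] left_inv_pos[of y] by (auto simp: branch_inv_def)
  then have "increasing_concave (\<lambda>y. G (branch_inv b y))"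
    using increasing_concave_compose[OF Cons.prems increasing_concave_branch_inv] by blast
  from Cons.IH[OF this] show ?case by (simp add: word_inv_Cons)
qed simp

lemma T_range: "x \<in> {0..<1} \<Longrightarrow> T x \<in> {0..<1}"
proof -
  assume "x \<in> {0..<1}"
  moreover have "0 \<le> T_left \<gamma> x" "T_left \<gamma> x < T_left \<gamma> (1/2)" if "0 \<le> x" "x < 1/2"
    using that T_left_strict_mono[of x "1/2"] by (auto simp: T_left_def)
  ultimately show ?thesis using T_left_half by (auto simp: T_map_def)
qed

lemma T_pow_range: "x \<in> {0..<1} \<Longrightarrow> (T ^^ n) x \<in> {0..<1}"
  by (induction n) (use T_range in auto)

definition itinerary :: "nat \<Rightarrow> real \<Rightarrow> bool list" where
  "itinerary n x = map (\<lambda>i. 1/2 \<le> (T ^^ i) x) [0..<n]"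

lemma itinerary_0: "itinerary 0 x = []"
  and itinerary_length [simp]: "length (itinerary n x) = n"
  by (simp_all add: itinerary_def)

lemma itinerary_Suc: "itinerary (Suc n) x = (1/2 \<le> x) # itinerary n (T x)"
  unfolding itinerary_def by (simp add: upt_conv_Cons map_Suc_upt[symmetric] funpow_swap1 del: upt_Suc)

lemma itinerary_add: "itinerary (m + n) x = itinerary m x @ itinerary n ((T ^^ m) x)"
  by (induction m arbitrary: x) (simp_all add: itinerary_0 itinerary_Suc funpow_swap1)

lemma branch_inv_mem_iff:
  assumes "x \<in> {0..<1}" "0 \<le> c" "c \<le> 1" "0 \<le> d" "d \<le> 1"
  shows "x \<in> {branch_inv b c..<branch_inv b d} \<longleftrightarrow> (1/2 \<le> x) = b \<and> T x \<in> {c..<d}"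
proof (cases "x < 1/2")
  case True
  then show ?thesis using assms left_inv_compare[of x c] left_inv_compare[of x d]
    by (cases b) (auto simp: branch_inv_def T_map_def)
next
  case False
  then show ?thesis using assms left_inv_range[of d]
    by (cases b) (auto simp: branch_inv_def T_map_def field_simps)
qed

text \<open>
  Since both branches of \<^term>\<open>T\<close> are onto, the image of an interval under the inverse branch of
  \<open>w\<close> consists of all points that follow \<open>w\<close> and then land in that interval.
\<close>
lemma word_inv_mem_iff:
  assumes "x \<in> {0..<1}" "0 \<le> c" "c \<le> 1" "0 \<le> d" "d \<le> 1"
  shows "x \<in> {word_inv w c..<word_inv w d} \<longleftrightarrow>
    itinerary (length w) x = w \<and> (T ^^ length w) x \<in> {c..<d}"
  using assms(1)
proof (induction w arbitrary: x)
  case (Cons b w)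
  have "x \<in> {word_inv (b # w) c..<word_inv (b # w) d} \<longleftrightarrow>
      (1/2 \<le> x) = b \<and> T x \<in> {word_inv w c..<word_inv w d}"
    unfolding word_inv_Cons using Cons.prems word_inv_range assms by (intro branch_inv_mem_iff) auto
  also have "\<dots> \<longleftrightarrow> (1/2 \<le> x) = b \<and> itinerary (length w) (T x) = w \<and> (T ^^ length w) (T x) \<in> {c..<d}"
    using Cons.IH[OF T_range[OF Cons.prems]] by simp
  finally show ?case by (simp add: itinerary_Suc funpow_swap1)
qed (simp add: itinerary_0)

lemma word_inv_subset: "0 \<le> c \<Longrightarrow> c \<le> 1 \<Longrightarrow> 0 \<le> d \<Longrightarrow> d \<le> 1 \<Longrightarrow>
    {word_inv w c..<word_inv w d} \<subseteq> {0..<1}"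
  using word_inv_range[of c w] word_inv_range[of d w] by auto

end

section \<open>Mass transported along words\<close>

lemma finite_words: "finite {w \<in> A. length (w :: bool list) = n}"
  by (rule finite_subset[OF _ finite_lists_length_eq[of UNIV n]]) auto

lemma split_before_last_occurrences:
  "k < count_list w x \<Longrightarrow> \<exists>u v. w = u @ x # v \<and> count_list v x = k"
proof (induction w)
  case (Cons y w)
  show ?case
  proof (cases "k < count_list w x")
    case True
    with Cons.IH obtain u v where "w = u @ x # v" "count_list v x = k" by blast
    then have "y # w = (y # u) @ x # v \<and> count_list v x = k" by simp
    then show ?thesis by blast
  next
    case False
    then have "y # w = [] @ x # w \<and> count_list w x = k"
      using Cons.prems by (auto split: if_splits)
    then show ?thesis by blast
  qed
qed simp

context intermittent_map
begin

abbreviation orbits :: "bool list set \<Rightarrow> nat \<Rightarrow> real \<Rightarrow> real \<Rightarrow> real set" where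
  "orbits A n c d \<equiv> {x \<in> {0..<1}. itinerary n x \<in> A \<and> (T ^^ n) x \<in> {c..<d}}"

text \<open>
  If \<open>G\<close> is an antiderivative of a density, this is the mass of the points that follow \<open>w\<close> and are
  then in the reference band \<open>[a (Suc N), a N)\<close>.
\<close>
definition band :: "(real \<Rightarrow> real) \<Rightarrow> nat \<Rightarrow> bool list \<Rightarrow> real" where
  "band G N w = G (word_inv w (a N)) - G (word_inv w (a (Suc N)))"

definition band_sum :: "(real \<Rightarrow> real) \<Rightarrow> nat \<Rightarrow> bool list set \<Rightarrow> nat \<Rightarrow> real" where
  "band_sum G N A n = (\<Sum>w | w \<in> A \<and> length w = n. band G N w)"

definition mass :: "bool list set \<Rightarrow> nat \<Rightarrow> real \<Rightarrow> real \<Rightarrow> real" where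
  "mass A n c d = (\<Sum>w | w \<in> A \<and> length w = n. word_inv w d - word_inv w c)"

lemma band_nonneg: "increasing_concave G \<Longrightarrow> 0 \<le> band G N w"
  using increasing_concaveD[OF increasing_concave_word_inv, of G "a (Suc N)" "a N" w]
    a_pos[of "Suc N"] a_Suc_less[of N] a_le_1[of N] by (simp add: band_def)

lemma band_sum_nonneg: "increasing_concave G \<Longrightarrow> 0 \<le> band_sum G N A n"
  unfolding band_sum_def by (intro sum_nonneg band_nonneg)

text \<open>
  After the letter \<open>True\<close> the orbit is in \<open>[1/2, 1)\<close>, to the right of the reference band. By
  concavity the density transported along \<open>u\<close> is there at most \<open>band G N u / (a N - a (Suc N))\<close>, and
  the points which go on to follow \<open>v\<close> into the band have length half of \<open>band (\<lambda>x. x) N v\<close>.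
\<close>
lemma band_append_right:
  assumes "increasing_concave G"
  shows "band G N (u @ True # v)
    \<le> band G N u * (band (\<lambda>x. x) N v / (2 * (a N - a (Suc N))))"
proof -
  define x y where "x = word_inv v (a (Suc N))" and "y = word_inv v (a N)"
  have xy: "0 \<le> x" "x \<le> y" "y \<le> 1"
    using word_inv_range[of "a (Suc N)" v] word_inv_range[of "a N" v]
      word_inv_le[of "a (Suc N)" "a N" v] a_pos[of "Suc N"] a_pos[of N] a_le_1[of "Suc N"] a_le_1[of N] a_Suc_less[of N]
    by (auto simp: x_def y_def)
  have "G (word_inv u ((y + 1) / 2)) - G (word_inv u ((x + 1) / 2))
      \<le> ((y + 1) / 2 - (x + 1) / 2) / (a N - a (Suc N))
          * (G (word_inv u (a N)) - G (word_inv u (a (Suc N))))"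
    using xy a_pos[of "Suc N"] a_Suc_less[of N] a_le_half[of N]
    by (intro increasing_concave_slope[OF increasing_concave_word_inv[OF assms]]) auto
  also have "((y + 1) / 2 - (x + 1) / 2) / (a N - a (Suc N)) = (y - x) / (2 * (a N - a (Suc N)))"
    using a_Suc_less[of N] by (simp add: field_simps)
  finally show ?thesis
    by (simp add: band_def word_inv_append word_inv_Cons branch_inv_def x_def y_def mult.commute)
qed

text \<open>
  Summing the preceding bound over all ways to cut gives a convolution, because the lengths of the
  two pieces add up to \<open>n - 1\<close>.
\<close>
lemma band_sum_split_at_right_branch:
  assumes G: "increasing_concave G" and "finite W"
    and W: "\<And>w. w \<in> W \<Longrightarrow> length w = n \<and> (\<exists>u\<in>A. \<exists>v\<in>B. w = u @ True # v)"
  shows "(\<Sum>w\<in>W. band G N w) \<le> (\<Sum>s<n. band_sum G N A (n - 1 - s)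
            * (band_sum (\<lambda>x. x) N B s / (2 * (a N - a (Suc N)))))"
proof -
  define P where "P s = {u \<in> A. length u = n - 1 - s} \<times> {v \<in> B. length v = s}" for s
  define S where "S = (SIGMA s:{..<n}. P s)"
  define g where "g = (\<lambda>(s::nat, u, v). u @ True # v)"
  have finP: "finite (P s)" for s unfolding P_def by (intro finite_cartesian_product finite_words)
  then have finS: "finite S" unfolding S_def by auto
  have "W \<subseteq> g ` S"
  proof
    fix w assume "w \<in> W"
    with W obtain u v where uv: "u \<in> A" "v \<in> B" "w = u @ True # v" "length w = n" by blast
    then have "(length v, u, v) \<in> S" by (auto simp: S_def P_def)
    then have "g (length v, u, v) \<in> g ` S" by (rule imageI)
    then show "w \<in> g ` S" using uv by (simp add: g_def)
  qed
  then have "(\<Sum>w\<in>W. band G N w) \<le> (\<Sum>w\<in>g ` S. band G N w)"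
    using finS by (intro sum_mono2) (auto intro: band_nonneg[OF G])
  also have "\<dots> \<le> (\<Sum>z\<in>S. band G N (g z))"
    using sum_image_le[OF finS, of "band G N" g] band_nonneg[OF G] by (simp add: o_def)
  also have "\<dots> = (\<Sum>s<n. \<Sum>(u, v)\<in>P s. band G N (u @ True # v))"
    unfolding S_def using finP by (subst sum.Sigma) (auto simp: g_def intro!: sum.cong)
  also have "\<dots> \<le> (\<Sum>s<n. \<Sum>(u, v)\<in>P s. band G N u * (band (\<lambda>x. x) N v / (2 * (a N - a (Suc N)))))"
    by (intro sum_mono) (use band_append_right[OF G] in auto)
  also have "\<dots> = (\<Sum>s<n. band_sum G N A (n - 1 - s)
            * (band_sum (\<lambda>x. x) N B s / (2 * (a N - a (Suc N)))))"
    unfolding P_def band_sum_def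
    by (simp add: sum.cartesian_product[symmetric] sum_product sum_divide_distrib)
  finally show ?thesis .
qed

text \<open>
  With no visit to \<open>[1/2, 1)\<close> the only word of length \<open>n\<close> leads straight down to the band, so the mass
  is a gap of the sequence \<open>G (a n)\<close>. Each further visit costs one convolution with the gaps of \<open>a\<close>,
  which preserves the exponent.
\<close>
lemma band_sum_few_visits_decay:
  assumes G: "increasing_concave G" and "\<kappa> > 1" "D \<ge> 0" "D' \<ge> 0"
    and incr: "\<And>n. G (a n) - G (a (Suc n)) \<le> D * (real n + 1) powr - \<kappa>"
    and gap: "\<And>n. a n - a (Suc n) \<le> D' * (real n + 1) powr - \<kappa>"
  shows "\<exists>C\<ge>0. \<forall>n. band_sum G N {w. count_list w True = j} n \<le> C * (real n + 1) powr - \<kappa>"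
proof (induction j)
  have no_visit: "{w. w \<in> {w. count_list w True = 0} \<and> length w = n} = {replicate n False}" for n
  proof (intro set_eqI iffI)
    fix w :: "bool list"
    assume "w \<in> {w. w \<in> {w. count_list w True = 0} \<and> length w = n}"
    then have "True \<notin> set w" "length w = n" by (auto simp: count_list_0_iff)
    then have "\<forall>b\<in>set w. b = False" by (metis (full_types))
    then have "replicate (length w) False = w" by (rule replicate_length_same)
    then show "w \<in> {replicate n False}" using \<open>length w = n\<close> by simp
  qed (auto simp: count_list_0_iff)
  have zero: "band_sum G' N {w. count_list w True = 0} n = G' (a (n + N)) - G' (a (Suc (n + N)))" for G' n
    unfolding band_sum_def no_visit by (simp add: band_def word_inv_replicate_left)
  have shift: "(real (n + N) + 1) powr - \<kappa> \<le> (real n + 1) powr - \<kappa>" for n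
    using \<open>\<kappa> > 1\<close> by (intro powr_mono2') auto
  case 0
  have "band_sum G N {w. count_list w True = 0} n \<le> D * (real n + 1) powr - \<kappa>" for n
    using incr[of "n + N"] mult_left_mono[OF shift[of n] \<open>D \<ge> 0\<close>] by (simp add: zero)
  then show ?case using \<open>D \<ge> 0\<close> by blast
  case (Suc j)
  then obtain C where C: "C \<ge> 0"
    "\<And>n. band_sum G N {w. count_list w True = j} n \<le> C * (real n + 1) powr - \<kappa>" by blast
  define R where "R = 2 * (a N - a (Suc N))"
  have "R > 0" using a_Suc_less[of N] by (simp add: R_def)
  define z where "z s = band_sum (\<lambda>x. x) N {w. count_list w True = 0} s / R" for s
  have z0: "0 \<le> z s" for s
    using band_sum_nonneg[OF increasing_concave_ident] \<open>R > 0\<close> by (simp add: z_def)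
  have z: "z s \<le> D' / R * (real s + 1) powr - \<kappa>" for s
    using gap[of "s + N"] mult_left_mono[OF shift[of s] \<open>D' \<ge> 0\<close>] \<open>R > 0\<close>
    by (simp add: z_def zero divide_right_mono)
  obtain E where E: "E \<ge> 0"
    "\<And>n. (\<Sum>s<n. band_sum G N {w. count_list w True = j} (n - 1 - s) * z s) \<le> E * (real n + 1) powr - \<kappa>"
    using convolution_polynomial_decay[OF \<open>\<kappa> > 1\<close> C(1) _ band_sum_nonneg[OF G] C(2) z0 z]
      \<open>D' \<ge> 0\<close> \<open>R > 0\<close> by (metis divide_nonneg_pos)
  have "band_sum G N {w. count_list w True = Suc j} n \<le> E * (real n + 1) powr - \<kappa>" for n
  proof -
    have "band_sum G N {w. count_list w True = Suc j} n
        \<le> (\<Sum>s<n. band_sum G N {w. count_list w True = j} (n - 1 - s) * z s)"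
      unfolding z_def R_def band_sum_def[of G N "{w. count_list w True = Suc j}"]
    proof (rule band_sum_split_at_right_branch[OF G finite_words])
      fix w assume w: "w \<in> {w \<in> {w. count_list w True = Suc j}. length w = n}"
      then obtain u v where "w = u @ True # v" "count_list v True = 0"
        using split_before_last_occurrences[of 0 w True] by auto
      with w show "length w = n \<and> (\<exists>u\<in>{w. count_list w True = j}. \<exists>v\<in>{w. count_list w True = 0}. w = u @ True # v)"
        by auto
    qed
    also note E(2)[of n]
    finally show ?thesis .
  qed
  then show ?case using E(1) by blast
qed

lemma finite_word_image_measure:
  assumes "finite W" "0 \<le> c" "c \<le> d" "d \<le> 1"
    and "disjoint_family_on (\<lambda>w. {word_inv w c..<word_inv w d}) W"
  shows "(\<Sum>w\<in>W. word_inv w d - word_inv w c) = measure lborel (\<Union>w\<in>W. {word_inv w c..<word_inv w d})"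
proof -
  have "measure lborel (\<Union>w\<in>W. {word_inv w c..<word_inv w d})
      = (\<Sum>w\<in>W. measure lborel {word_inv w c..<word_inv w d})"
    using assms by (intro measure_finite_Union) (auto simp: word_inv_le)
  also have "\<dots> = (\<Sum>w\<in>W. word_inv w d - word_inv w c)"
    using assms by (intro sum.cong) (auto simp: word_inv_le)
  finally show ?thesis by simp
qed

lemma cylinder_Union:
  assumes "0 \<le> c" "c \<le> d" "d \<le> 1"
  shows "orbits A n c d
    = (\<Union>w\<in>{w \<in> A. length w = n}. {word_inv w c..<word_inv w d})" (is "?L = ?R")
proof (intro set_eqI iffI)
  fix x assume "x \<in> ?L"
  then show "x \<in> ?R" using word_inv_mem_iff[of x c d "itinerary n x"] assms by auto
next
  fix x assume "x \<in> ?R"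
  then obtain w where w: "w \<in> A" "length w = n" "x \<in> {word_inv w c..<word_inv w d}" by blast
  moreover have "x \<in> {0..<1}" using w(3) word_inv_subset[of c d w] assms by auto
  ultimately show "x \<in> ?L" using word_inv_mem_iff[of x c d w] assms by auto
qed

lemma cylinder_disjoint:
  assumes "0 \<le> c" "c \<le> d" "d \<le> 1"
  shows "disjoint_family_on (\<lambda>w. {word_inv w c..<word_inv w d}) {w \<in> A. length w = n}"
  unfolding disjoint_family_on_def
proof (intro ballI impI)
  fix w w' assume w: "w \<in> {w \<in> A. length w = n}" "w' \<in> {w \<in> A. length w = n}" "w \<noteq> w'"
  have "x \<notin> {word_inv w' c..<word_inv w' d}" if "x \<in> {word_inv w c..<word_inv w d}" for x
    using that w word_inv_subset[of c d w] word_inv_mem_iff[of x c d w] word_inv_mem_iff[of x c d w'] assms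
    by auto
  then show "{word_inv w c..<word_inv w d} \<inter> {word_inv w' c..<word_inv w' d} = {}" by blast
qed

text \<open>
  Sums over words thus turn into measures of sets of orbits. Below, inequalities between them are
  proved by inclusions of such sets, while concavity is applied word by word.
\<close>
lemma mass_eq_measure:
  assumes "0 \<le> c" "c \<le> d" "d \<le> 1"
  shows "mass A n c d = measure lborel (orbits A n c d)"
  unfolding mass_def cylinder_Union[OF assms]
  by (rule finite_word_image_measure[OF finite_words assms cylinder_disjoint[OF assms]])

lemma cylinder_fmeasurable:
  assumes "0 \<le> c" "c \<le> d" "d \<le> 1"
  shows "orbits A n c d \<in> fmeasurable lborel"
  unfolding cylinder_Union[OF assms] using assms
  by (intro fmeasurable.finite_UN finite_words fmeasurableI) (auto simp: word_inv_le)

lemma mass_mono_set: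
  assumes "0 \<le> c" "c \<le> d" "d \<le> 1" "S \<in> fmeasurable lborel"
    and "orbits A n c d \<subseteq> S"
  shows "mass A n c d \<le> measure lborel S"
  unfolding mass_eq_measure[OF assms(1-3)]
  by (rule measure_mono_fmeasurable[OF assms(5) fmeasurableD[OF cylinder_fmeasurable[OF assms(1-3)]] assms(4)])

lemma mass_nonneg: "0 \<le> c \<Longrightarrow> c \<le> d \<Longrightarrow> d \<le> 1 \<Longrightarrow> 0 \<le> mass A n c d"
  by (simp add: mass_eq_measure)

lemma mass_le_1: "0 \<le> c \<Longrightarrow> c \<le> d \<Longrightarrow> d \<le> 1 \<Longrightarrow> mass A n c d \<le> 1"
proof -
  assume "0 \<le> c" "c \<le> d" "d \<le> 1"
  then have "mass A n c d \<le> measure lborel {0..<1::real}"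
    by (rule mass_mono_set) (auto intro: fmeasurableI)
  then show ?thesis by simp
qed

end

section \<open>Orbits that avoid a cylinder\<close>

abbreviation avoiding :: "bool list \<Rightarrow> bool list set" where
  "avoiding v \<equiv> {w. \<not> sublist v w}"

lemma avoiding_append_left: "w @ u \<in> avoiding v \<Longrightarrow> w \<in> avoiding v"
  and avoiding_append_right: "w @ u \<in> avoiding v \<Longrightarrow> u \<in> avoiding v"
  by (auto simp: sublist_append)

context intermittent_map
begin

lemma mass_add_disjoint_le:
  assumes c: "0 \<le> c1" "c1 \<le> d1" "d1 \<le> 1" "0 \<le> c2" "c2 \<le> d2" "d2 \<le> 1"
      "0 \<le> c" "c \<le> d" "d \<le> 1"
    and sub: "\<And>x. x \<in> {0..<1} \<Longrightarrow> itinerary n1 x \<in> A1 \<Longrightarrow> (T ^^ n1) x \<in> {c1..<d1} \<Longrightarrow>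
        itinerary n x \<in> A \<and> (T ^^ n) x \<in> {c..<d}"
      "\<And>x. x \<in> {0..<1} \<Longrightarrow> itinerary n2 x \<in> A2 \<Longrightarrow> (T ^^ n2) x \<in> {c2..<d2} \<Longrightarrow>
        itinerary n x \<in> A \<and> (T ^^ n) x \<in> {c..<d}"
    and disj: "\<And>x. x \<in> {0..<1} \<Longrightarrow> itinerary n1 x \<in> A1 \<Longrightarrow> (T ^^ n1) x \<in> {c1..<d1} \<Longrightarrow>
       itinerary n2 x \<in> A2 \<Longrightarrow> (T ^^ n2) x \<in> {c2..<d2} \<Longrightarrow> False"
  shows "mass A1 n1 c1 d1 + mass A2 n2 c2 d2 \<le> mass A n c d"
proof -
  define S1 where "S1 = orbits A1 n1 c1 d1"
  define S2 where "S2 = orbits A2 n2 c2 d2"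
  define S where "S = orbits A n c d"
  have fm: "S1 \<in> fmeasurable lborel" "S2 \<in> fmeasurable lborel" "S \<in> fmeasurable lborel"
    unfolding S1_def S2_def S_def using c by (intro cylinder_fmeasurable; simp)+
  have "measure lborel S1 + measure lborel S2 = measure lborel (S1 \<union> S2)"
  proof (intro measure_Union[symmetric] fmeasurableD fm)
    show "emeasure lborel S1 \<noteq> \<infinity>" "emeasure lborel S2 \<noteq> \<infinity>"
      using fm fmeasurableD2 by auto
    show "S1 \<inter> S2 = {}" using disj unfolding S1_def S2_def by blast
  qed
  also have "\<dots> \<le> measure lborel S"
  proof (rule measure_mono_fmeasurable)
    show "S1 \<union> S2 \<subseteq> S" using sub unfolding S1_def S2_def S_def by blast
    show "S1 \<union> S2 \<in> sets lborel" using fm by (intro fmeasurableD fmeasurable.Un)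
  qed (rule fm)
  finally show ?thesis
    using c by (simp add: mass_eq_measure S1_def S2_def S_def)
qed

text \<open>
  By concavity the avoiding mass in \<open>[1/2, 1)\<close> at time \<open>n\<close> is at most a constant times the avoiding mass
  in the upper part \<open>[x, y)\<close> of the cylinder of \<open>v\<close>; this cylinder lies to the left of \<open>1/2\<close> since the
  first letter of \<open>v\<close> is \<open>False\<close>. Mass that is there at time \<open>n\<close> completes the block \<open>v\<close>, and so is lost,
  by time \<open>n + length v\<close>. The losses form a telescoping sum, bounded by \<open>length v\<close> times the initial
  mass.
\<close>
lemma visits_summable:
  assumes v: "v = False # v'"
  obtains C where "\<And>n. (\<Sum>i<n. mass (avoiding v) i (1/2) 1) \<le> C"
proof -
  define A where "A = avoiding v"
  define K where "K = length v"
  define m where "m n = mass A n 0 1" for n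
  define x y where "x = word_inv v (1/2)" and "y = word_inv v 1"
  have xy: "0 < x" "x < y" "y \<le> 1/2"
    using word_inv_pos[of "1/2" v] word_inv_less[of "1/2" 1 v] word_inv_range[of 1 v']
      left_inv_range[of "word_inv v' 1"]
    by (auto simp: x_def y_def v word_inv_Cons branch_inv_def)
  \<comment> \<open>The ratio of the lengths of \<open>[1/2, 1)\<close> and \<open>[x, y)\<close>. Here \<open>x\<close> is the image of \<open>1/2\<close>, not of \<open>0\<close>,
    in order to stay inside \<open>(0, 1]\<close>.\<close>
  define k where "k = 1 / (2 * (y - x))"
  have "0 \<le> k" using xy by (simp add: k_def)
  have slope: "word_inv w 1 - word_inv w (1/2) \<le> k * (word_inv w y - word_inv w x)" for w
    using increasing_concave_slope[OF increasing_concave_word_inv[OF increasing_concave_ident], of x y "1/2" 1 w] xy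
    by (simp add: k_def)
  have "mass A n (1/2) 1 \<le> k * mass A n x y" for n
    unfolding mass_def sum_distrib_left by (intro sum_mono slope)
  moreover have "mass A n x y \<le> m n - m (n + K)" for n
  proof -
    have "mass A n x y + mass A (n + K) 0 1 \<le> mass A n 0 1"
    proof (rule mass_add_disjoint_le)
      fix z assume z: "z \<in> {0..<1}" "itinerary (n + K) z \<in> A"
      then show "itinerary n z \<in> A \<and> (T ^^ n) z \<in> {0..<1}"
        using T_pow_range[OF z(1)] avoiding_append_left by (auto simp: A_def itinerary_add)
      assume "(T ^^ n) z \<in> {x..<y}"
      then have "itinerary K ((T ^^ n) z) = v"
        unfolding x_def y_def K_def using T_pow_range[OF z(1)]
        by (subst (asm) word_inv_mem_iff) auto
      with z(2) show False by (simp add: A_def itinerary_add)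
    qed (use xy in auto)
    then show ?thesis by (simp add: m_def)
  qed
  ultimately have visit: "mass A n (1/2) 1 \<le> k * (m n - m (n + K))" for n
    using \<open>0 \<le> k\<close> mult_left_mono order_trans by blast
  have telescope: "(\<Sum>i<n. m i - m (i + K)) = (\<Sum>i<K. m i) - (\<Sum>i<K. m (n + i))" for n
  proof (induction n)
    case (Suc n)
    have "(\<Sum>i<K. m (n + i)) - (\<Sum>i<K. m (Suc n + i)) = (\<Sum>i<K. m (n + i) - m (n + Suc i))"
      by (simp add: sum_subtractf)
    also have "\<dots> = m n - m (n + K)"
      using sum_lessThan_telescope'[of "\<lambda>i. m (n + i)" K] by simp
    finally show ?case using Suc by simp
  qed simp
  have m: "0 \<le> m n" "m n \<le> 1" for n
    unfolding m_def by (simp_all add: mass_nonneg mass_le_1)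
  have "(\<Sum>i<n. mass A i (1/2) 1) \<le> k * real K" for n
  proof -
    have "(\<Sum>i<n. mass A i (1/2) 1) \<le> (\<Sum>i<n. k * (m i - m (i + K)))"
      by (intro sum_mono visit)
    also have "\<dots> = k * ((\<Sum>i<K. m i) - (\<Sum>i<K. m (n + i)))"
      by (simp add: telescope[symmetric] sum_distrib_left)
    also have "\<dots> \<le> k * ((\<Sum>i<K. 1) - 0)"
      using m \<open>0 \<le> k\<close> by (intro mult_left_mono diff_mono sum_mono sum_nonneg) auto
    finally show ?thesis by simp
  qed
  then show ?thesis unfolding A_def by (rule that)
qed

text \<open>
  A point of \<open>[0, d)\<close> has come either from \<open>[0, left_inv d)\<close> or through the right branch.
\<close>
lemma mass_near_0_step:
  assumes "0 \<le> d" "d \<le> 1"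
  shows "mass (avoiding v) (Suc n) 0 d
    \<le> mass (avoiding v) n 0 (left_inv d) + mass (avoiding v) n (1/2) 1"
proof -
  have "mass (avoiding v) (Suc n) 0 d
      = measure lborel (orbits (avoiding v) (Suc n) 0 d)"
    using assms by (intro mass_eq_measure) auto
  also have "\<dots> \<le> measure lborel (orbits (avoiding v) n 0 (left_inv d)
      \<union> orbits (avoiding v) n (1/2) 1)"
  proof (rule measure_mono_fmeasurable)
    show "orbits (avoiding v) (Suc n) 0 d \<subseteq>
      orbits (avoiding v) n 0 (left_inv d)
      \<union> orbits (avoiding v) n (1/2) 1"
    proof
      fix x assume "x \<in> orbits (avoiding v) (Suc n) 0 d"
      then have x: "x \<in> {0..<1}" "itinerary (n + 1) x \<in> avoiding v" "T ((T ^^ n) x) \<in> {0..<d}" by auto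
      have av: "itinerary n x \<in> avoiding v"
        using x(2) avoiding_append_left unfolding itinerary_add by blast
      have r: "(T ^^ n) x \<in> {0..<1}" by (rule T_pow_range[OF x(1)])
      show "x \<in> orbits (avoiding v) n 0 (left_inv d)
        \<union> orbits (avoiding v) n (1/2) 1"
        using x r av branch_inv_mem_iff[OF r, of 0 d False] assms
        by (cases "1/2 \<le> (T ^^ n) x") (auto simp: branch_inv_def left_inv_0)
    qed
  next
    show "orbits (avoiding v) (Suc n) 0 d \<in> sets lborel"
      using assms by (intro fmeasurableD cylinder_fmeasurable) auto
    show "orbits (avoiding v) n 0 (left_inv d)
      \<union> orbits (avoiding v) n (1/2) 1 \<in> fmeasurable lborel"
      using assms left_inv_range[of d] by (intro fmeasurable.Un cylinder_fmeasurable) auto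
  qed
  also have "\<dots> \<le> measure lborel (orbits (avoiding v) n 0 (left_inv d))
      + measure lborel (orbits (avoiding v) n (1/2) 1)"
    using assms left_inv_range[of d] by (intro measure_Un_le fmeasurableD cylinder_fmeasurable) auto
  also have "\<dots> = mass (avoiding v) n 0 (left_inv d) + mass (avoiding v) n (1/2) 1"
    using assms left_inv_range[of d] by (simp add: mass_eq_measure)
  finally show ?thesis .
qed

lemma mass_near_0_steps:
  assumes "0 \<le> d" "d \<le> 1"
  shows "mass (avoiding v) (j + i) 0 d
    \<le> mass (avoiding v) j 0 (word_inv (replicate i False) d)
        + (\<Sum>s<i. mass (avoiding v) (j + s) (1/2) 1)"
  using assms
proof (induction i arbitrary: d)
  case (Suc i)
  have l: "0 \<le> left_inv d" "left_inv d \<le> 1" using left_inv_range[of d] Suc.prems by auto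
  have "mass (avoiding v) (Suc (j + i)) 0 d
      \<le> mass (avoiding v) (j + i) 0 (left_inv d) + mass (avoiding v) (j + i) (1/2) 1"
    by (rule mass_near_0_step[OF Suc.prems])
  also note Suc.IH[OF l]
  also have "word_inv (replicate i False) (left_inv d) = word_inv (replicate (Suc i) False) d"
    using word_inv_append[of "replicate i False" "[False]" d]
    by (simp add: word_inv_Cons branch_inv_def replicate_append_same)
  finally show ?case by simp
qed simp

lemma word_inv_replicate_left_1: "word_inv (replicate (Suc i) False) 1 = a i"
proof -
  have "word_inv (replicate i False) (word_inv [False] 1) = a i"
    using word_inv_replicate_left[of i 0] by (simp add: word_inv_Cons branch_inv_def left_inv_1 a_0)
  then show ?thesis by (metis replicate_append_same word_inv_append replicate_Suc)
qed

text \<open>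
  An orbit that avoids \<open>v\<close> up to time \<open>j + i\<close> either visits \<open>[1/2, 1)\<close> from time \<open>j\<close> on, which is
  unlikely for large \<open>j\<close> by summability, or is already extremely close to \<open>0\<close> at time \<open>j\<close>, which
  for fixed \<open>j\<close> is unlikely when \<open>i\<close> is large.
\<close>
lemma mass_avoiding_tendsto_0:
  assumes v: "v = False # v'"
  shows "(\<lambda>n. mass (avoiding v) n 0 1) \<longlonglongrightarrow> 0"
proof (rule LIMSEQ_I)
  fix r :: real assume "0 < r"
  define Y where "Y i = mass (avoiding v) i (1/2) 1" for i
  have Y0: "0 \<le> Y i" for i by (simp add: Y_def mass_nonneg)
  obtain C where C: "\<And>n. (\<Sum>i<n. Y i) \<le> C" unfolding Y_def using visits_summable[OF v] by blast
  have sm: "summable Y"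
    by (rule summableI_nonneg_bounded[OF Y0 C])
  have "(\<lambda>k. \<Sum>s. Y (s + k)) \<longlonglongrightarrow> 0" by (rule suminf_exist_split2[OF sm])
  then have "eventually (\<lambda>k. (\<Sum>s. Y (s + k)) < r / 2) sequentially"
    using \<open>0 < r\<close> by (intro order_tendstoD) auto
  then obtain j where j: "(\<Sum>s. Y (s + j)) < r / 2"
    unfolding eventually_sequentially by blast
  have tail: "(\<Sum>s<i. Y (j + s)) < r / 2" for i
  proof -
    have "(\<Sum>s<i. Y (s + j)) \<le> (\<Sum>s. Y (s + j))"
      using sm Y0 by (intro sum_le_suminf) (auto simp: summable_iff_shift)
    with j show ?thesis by (simp add: add.commute)
  qed
  have "(\<lambda>i. word_inv w (a i)) \<longlonglongrightarrow> word_inv w 0" for w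
    by (rule continuous_on_tendsto_compose[OF word_inv_cont a_tendsto_0])
      (auto simp: less_imp_le[OF a_pos] a_le_1)
  then have "(\<lambda>i. mass (avoiding v) j 0 (a i)) \<longlonglongrightarrow> (\<Sum>w | w \<in> avoiding v \<and> length w = j. word_inv w 0 - word_inv w 0)"
    unfolding mass_def by (intro tendsto_intros)
  then have "(\<lambda>i. mass (avoiding v) j 0 (a i)) \<longlonglongrightarrow> 0" by simp
  then have "eventually (\<lambda>i. mass (avoiding v) j 0 (a i) < r / 2) sequentially"
    using \<open>0 < r\<close> by (intro order_tendstoD) auto
  then obtain i0 where i0: "\<And>i. i \<ge> i0 \<Longrightarrow> mass (avoiding v) j 0 (a i) < r / 2"
    unfolding eventually_sequentially by blast
  show "\<exists>n0. \<forall>n\<ge>n0. norm (mass (avoiding v) n 0 1 - 0) < r"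
  proof (intro exI allI impI)
    fix n assume "n \<ge> j + Suc i0"
    define i where "i = n - j - 1"
    have n: "n = j + Suc i" "i \<ge> i0" using \<open>n \<ge> j + Suc i0\<close> by (auto simp: i_def)
    have "mass (avoiding v) n 0 1 \<le> mass (avoiding v) j 0 (a i) + (\<Sum>s<Suc i. Y (j + s))"
      using mass_near_0_steps[of 1 v j "Suc i"] unfolding n(1) word_inv_replicate_left_1 Y_def by simp
    also have "\<dots> < r" using i0[OF n(2)] tail[of "Suc i"] by linarith
    finally show "norm (mass (avoiding v) n 0 1 - 0) < r" by (simp add: mass_nonneg)
  qed
qed

text \<open>
  From the band an orbit reaches \<open>[1/2, 1)\<close> for the first time after exactly \<open>Suc N\<close> steps. The time at
  which a point is in the band with exactly \<open>k\<close> visits behind it is therefore determined by the point,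
  so the sets counted on the left are disjoint, also for words of different lengths. All of them
  consist of points whose first \<open>k\<close> letters avoid \<open>v\<close>.
\<close>
lemma sum_band_le_mass:
  "(\<Sum>s<M. band_sum (\<lambda>x. x) N {u \<in> avoiding v. count_list u True = k} s) \<le> mass (avoiding v) k 0 1"
proof -
  define U where "U = {u \<in> avoiding v. count_list u True = k}"
  define W where "W = (\<Union>s<M. {u \<in> U. length u = s})"
  define J where "J u = {word_inv u (a (Suc N))..<word_inv u (a N)}" for u
  have finW: "finite W" unfolding W_def by (intro finite_UN_I finite_words) auto
  have ar: "0 \<le> a n" "a n \<le> 1" for n using a_pos[of n] a_le_1[of n] by auto
  have mem: "x \<in> {0..<1} \<and> itinerary (length u) x = u \<and> (T ^^ length u) x \<in> {a (Suc N)..<a N}"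
    if "x \<in> J u" for x u
    using that word_inv_subset[of "a (Suc N)" "a N" u] word_inv_mem_iff[of x "a (Suc N)" "a N" u] ar
    unfolding J_def by blast
  have no_overlap: "u = u'" if x: "x \<in> J u" "x \<in> J u'" and U: "u \<in> U" "u' \<in> U"
    and len: "length u \<le> length u'" for x u u'
  proof -
    define i where "i = length u' - length u"
    have i: "length u' = length u + i" using len by (simp add: i_def)
    define y where "y = (T ^^ length u) x"
    have y: "y \<in> {0..<1}" unfolding y_def using T_pow_range mem[OF x(1)] by blast
    have u': "u' = u @ itinerary i y"
      using mem[OF x(1)] mem[OF x(2)] itinerary_add[of "length u" i x] unfolding y_def i by simp
    then have "count_list (itinerary i y) True = 0" using U by (simp add: U_def)
    then have "True \<notin> set (itinerary i y)" by (simp add: count_list_0_iff)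
    then have "\<forall>b\<in>set (itinerary i y). b = False" by (metis (full_types))
    then have rep: "itinerary i y = replicate i False"
      using replicate_length_same[of "itinerary i y" False] by simp
    have "(T ^^ i) y \<in> {a (Suc N)..<a N}"
      using mem[OF x(2)] unfolding y_def i by (simp add: funpow_add add.commute)
    then have "y \<in> {word_inv (replicate i False) (a (Suc N))..<word_inv (replicate i False) (a N)}"
      using rep word_inv_mem_iff[OF y, of "a (Suc N)" "a N" "replicate i False"] ar by simp
    then have "y < a (i + N)" by (simp add: word_inv_replicate_left)
    moreover have "a (Suc N) \<le> y" using mem[OF x(1)] by (simp add: y_def)
    ultimately have "\<not> Suc N \<le> i + N" using a_antimono[of "Suc N" "i + N"] by linarith
    then have "i = 0" by simp
    with u' show "u = u'" by (simp add: itinerary_0)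
  qed
  have disj: "disjoint_family_on J W"
    unfolding disjoint_family_on_def
  proof (intro ballI impI)
    fix u u' assume uu: "u \<in> W" "u' \<in> W" "u \<noteq> u'"
    have "x \<notin> J u'" if "x \<in> J u" for x
      using no_overlap[of x u u'] no_overlap[of x u' u] uu that by (auto simp: W_def) (metis nat_le_linear)
    then show "J u \<inter> J u' = {}" by blast
  qed
  have "(\<Sum>s<M. band_sum (\<lambda>x. x) N U s) = (\<Sum>u\<in>W. band (\<lambda>x. x) N u)"
    unfolding band_sum_def W_def
    by (subst sum.UNION_disjoint) (auto intro: finite_words)
  also have "\<dots> = measure lborel (\<Union>u\<in>W. J u)"
    unfolding band_def J_def using disj[unfolded J_def] ar a_Suc_less[of N] finW
    by (intro finite_word_image_measure) (auto simp: less_imp_le)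
  also have "\<dots> \<le> measure lborel (orbits (avoiding v) k 0 1)"
  proof (rule measure_mono_fmeasurable)
    show "(\<Union>u\<in>W. J u) \<subseteq> orbits (avoiding v) k 0 1"
    proof
      fix x assume "x \<in> (\<Union>u\<in>W. J u)"
      then obtain u where u: "u \<in> U" "x \<in> J u" by (auto simp: W_def)
      have "k \<le> length u" using u(1) count_le_length[of u True] by (simp add: U_def)
      then obtain i where "length u = k + i" using le_Suc_ex by blast
      then have "u = itinerary k x @ itinerary i ((T ^^ k) x)"
        using mem[OF u(2)] itinerary_add[of k i x] by simp
      then have "itinerary k x \<in> avoiding v" using u(1) avoiding_append_left by (auto simp: U_def)
      then show "x \<in> orbits (avoiding v) k 0 1"
        using mem[OF u(2)] T_pow_range by auto
    qed
    show "(\<Union>u\<in>W. J u) \<in> sets lborel" using finW by (auto simp: J_def)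
  qed (rule cylinder_fmeasurable, auto)
  also have "\<dots> = mass (avoiding v) k 0 1" by (rule mass_eq_measure[symmetric]) auto
  finally show ?thesis by (simp add: U_def)
qed

text \<open>
  Words with at most \<open>k\<close> visits to \<open>[1/2, 1)\<close> are covered by \<open>band_sum_few_visits_decay\<close>. Any other
  avoiding word is cut in front of its last \<open>k + 1\<close> visits; both pieces avoid \<open>v\<close> as well, which
  yields the renewal inequality. The number \<open>k\<close> is chosen so large that the kernel has total mass
  at most \<open>1/2\<close>.
\<close>
lemma band_sum_avoiding_decay:
  assumes v: "v = False # v'" and G: "increasing_concave G" and "\<kappa> > 1" "D \<ge> 0" "D' \<ge> 0"
    and incr: "\<And>n. G (a n) - G (a (Suc n)) \<le> D * (real n + 1) powr - \<kappa>"
    and gap: "\<And>n. a n - a (Suc n) \<le> D' * (real n + 1) powr - \<kappa>"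
  obtains C where "C \<ge> 0" "\<And>n. band_sum G N (avoiding v) n \<le> C * (real n + 1) powr - \<kappa>"
proof -
  \<comment> \<open>The constant lost in \<open>band_append_right\<close>; \<open>k\<close> is chosen to make up for it.\<close>
  define R where "R = 2 * (a N - a (Suc N))"
  have "R > 0" using a_Suc_less[of N] by (simp add: R_def)
  have "eventually (\<lambda>k. mass (avoiding v) k 0 1 < R / 2) sequentially"
    using mass_avoiding_tendsto_0[OF v] \<open>R > 0\<close> by (intro order_tendstoD) auto
  then obtain k where k: "mass (avoiding v) k 0 1 < R / 2" by (auto simp: eventually_sequentially)
  define U where "U = {u \<in> avoiding v. count_list u True = k}"
  define q where "q s = band_sum (\<lambda>x. x) N U s / R" for s
  define E where "E j = {w. count_list w True = j}" for j
  define b where "b n = (\<Sum>j\<le>k. band_sum G N (E j) n)" for n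
  have q0: "0 \<le> q s" for s
    using band_sum_nonneg[OF increasing_concave_ident] \<open>R > 0\<close> by (simp add: q_def)
  have q_sum: "(\<Sum>s<n. q s) \<le> 1/2" for n
  proof -
    have "(\<Sum>s<n. q s) = (\<Sum>s<n. band_sum (\<lambda>x. x) N U s) / R"
      by (simp add: q_def sum_divide_distrib)
    also have "\<dots> \<le> (R / 2) / R"
      using sum_band_le_mass[of N v k n] k \<open>R > 0\<close> by (intro divide_right_mono) (auto simp: U_def)
    finally show ?thesis using \<open>R > 0\<close> by simp
  qed
  have few: "\<exists>C\<ge>0. \<forall>n. band_sum G' N (E j) n \<le> C * (real n + 1) powr - \<kappa>"
    if "increasing_concave G'" "D'' \<ge> 0" "\<And>n. G' (a n) - G' (a (Suc n)) \<le> D'' * (real n + 1) powr - \<kappa>"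
    for G' D'' j
    unfolding E_def using band_sum_few_visits_decay[OF that(1) \<open>\<kappa> > 1\<close> that(2) \<open>D' \<ge> 0\<close> that(3) gap] .
  obtain B where B: "B \<ge> 0" "\<And>n. band_sum (\<lambda>x. x) N (E k) n \<le> B * (real n + 1) powr - \<kappa>"
    using few[OF increasing_concave_ident \<open>D' \<ge> 0\<close> gap] by blast
  have "q n \<le> B / R * (real n + 1) powr - \<kappa>" for n
  proof -
    have "band_sum (\<lambda>x. x) N U n \<le> band_sum (\<lambda>x. x) N (E k) n"
      unfolding band_sum_def using band_nonneg[OF increasing_concave_ident]
      by (intro sum_mono2 finite_words) (auto simp: U_def E_def)
    also note B(2)[of n]
    finally show ?thesis using \<open>R > 0\<close> by (simp add: q_def divide_right_mono)
  qed
  moreover have "\<exists>C. \<forall>j. C j \<ge> 0 \<and> (\<forall>n. band_sum G N (E j) n \<le> C j * (real n + 1) powr - \<kappa>)"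
    using few[OF G \<open>D \<ge> 0\<close> incr] by metis
  then obtain Cj where Cj: "\<And>j. 0 \<le> Cj j" "\<And>j n. band_sum G N (E j) n \<le> Cj j * (real n + 1) powr - \<kappa>"
    by blast
  have "b n \<le> (\<Sum>j\<le>k. Cj j) * (real n + 1) powr - \<kappa>" for n
    unfolding b_def sum_distrib_right by (intro sum_mono Cj)
  moreover have "band_sum G N (avoiding v) n
      \<le> b n + (\<Sum>s<n. band_sum G N (avoiding v) (n - 1 - s) * q s)" for n
  proof -
    define W where "W = {w \<in> avoiding v. length w = n}"
    define W1 where "W1 = {w \<in> W. count_list w True \<le> k}"
    define W2 where "W2 = {w \<in> W. k < count_list w True}"
    have fin: "finite W" unfolding W_def by (rule finite_words)
    have "band_sum G N (avoiding v) n = (\<Sum>w\<in>W1. band G N w) + (\<Sum>w\<in>W2. band G N w)"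
      unfolding band_sum_def W_def[symmetric] using fin
      by (subst sum.union_disjoint[symmetric]) (auto simp: W1_def W2_def intro!: sum.cong)
    moreover have "(\<Sum>w\<in>W1. band G N w) \<le> b n"
    proof -
      have "b n = (\<Sum>w\<in>(\<Union>j\<le>k. {w \<in> E j. length w = n}). band G N w)"
        unfolding b_def band_sum_def
      proof (rule sum.UNION_disjoint[symmetric])
        show "\<forall>j\<in>{..k}. finite {w \<in> E j. length w = n}" by (intro ballI finite_words)
      qed (auto simp: E_def)
      moreover have "(\<Sum>w\<in>W1. band G N w) \<le> (\<Sum>w\<in>(\<Union>j\<le>k. {w \<in> E j. length w = n}). band G N w)"
        by (intro sum_mono2 finite_UN_I finite_words)
          (auto intro: band_nonneg[OF G] simp: W1_def W_def E_def)
      ultimately show ?thesis by simp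
    qed
    moreover have "(\<Sum>w\<in>W2. band G N w) \<le> (\<Sum>s<n. band_sum G N (avoiding v) (n - 1 - s) * q s)"
      unfolding q_def R_def
    proof (rule band_sum_split_at_right_branch[OF G])
      show "finite W2" using fin by (simp add: W2_def)
      fix w assume w: "w \<in> W2"
      then obtain u t where ut: "w = u @ True # t" "count_list t True = k"
        using split_before_last_occurrences[of k w True] by (auto simp: W2_def)
      have "w \<in> avoiding v" using w by (simp add: W2_def W_def)
      then have "u \<in> avoiding v" "t \<in> avoiding v"
        using avoiding_append_left[of u "True # t"] avoiding_append_right[of "u @ [True]" t]
        by (auto simp: ut(1))
      then show "length w = n \<and> (\<exists>u\<in>avoiding v. \<exists>t\<in>U. w = u @ True # t)"
        using w ut by (auto simp: U_def W2_def W_def)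
    qed
    ultimately show ?thesis by linarith
  qed
  ultimately show ?thesis
    using defective_renewal_polynomial_decay[of \<kappa> "1/2" "B / R" "\<Sum>j\<le>k. Cj j" q b "band_sum G N (avoiding v)"]
      that \<open>\<kappa> > 1\<close> B(1) \<open>R > 0\<close> q0 q_sum Cj(1) by (auto simp: sum_nonneg)
qed

section \<open>The hole and the survivors\<close>

lemma T_measurable: "T \<in> borel_measurable borel"
  unfolding T_map_def[abs_def] T_left_def[abs_def] by measurable

lemma T_pow_measurable: "T ^^ n \<in> borel_measurable borel"
  by (rule measurable_compose_n[OF T_measurable])

lemma word_inv_replicate_left_0: "word_inv (replicate n False) 0 = 0"
  by (induction n) (auto simp: word_inv_Cons branch_inv_def left_inv_0)

text \<open>
  Membership in an element of the partition is decided by finitely many letters of the itinerary.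
  The letters of times \<open>0, \<dots>, l\<close> determine the pulled back partitions, and those of times
  \<open>0, \<dots>, n\<close> decide membership in the \<open>n\<close>-th interval of \<open>part_J\<close>, that is in
  \<open>word_inv (replicate n False) ` {1/2..<1}\<close>.
\<close>
lemma hole_structure:
  assumes H: "H \<in> part_Jt \<gamma> l"
  obtains w N where "\<And>x. x \<in> {0..<1} \<Longrightarrow> itinerary (length w) x = w \<Longrightarrow> x \<in> H"
    and "\<And>x. x \<in> H \<Longrightarrow> a N \<le> x" and "H \<in> sets borel"
proof -
  define \<P> where "\<P> = insert (part_J \<gamma>) ((\<lambda>i. pullback_part \<gamma> i part_P) ` {..l})"
  have "H \<in> common_refinement \<P>" using H by (simp add: part_Jt_def \<P>_def)
  then obtain F where F: "\<And>P. P \<in> \<P> \<Longrightarrow> F P \<in> P" and HF: "H = \<Inter> (F ` \<P>)" and "H \<noteq> {}"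
    by (auto simp: common_refinement Pi_iff)
  then obtain x0 where x0: "x0 \<in> H" by blast
  define J where "J = F (part_J \<gamma>)"
  have "J \<in> part_J \<gamma>" unfolding J_def by (rule F) (simp add: \<P>_def)
  then have "\<exists>n. J = {word_inv (replicate n False) (1/2)..<word_inv (replicate n False) 1}"
  proof (cases "J = {1/2..<1}")
    case True
    then have "J = {word_inv (replicate 0 False) (1/2)..<word_inv (replicate 0 False) 1}" by simp
    then show ?thesis by blast
  next
    case False
    with \<open>J \<in> part_J \<gamma>\<close> obtain n where n: "n \<ge> 1" "J = {a n..<a (n - 1)}"
      by (auto simp: part_J_def)
    then obtain m where m: "n = Suc m" by (cases n) auto
    have "word_inv (replicate n False) (1/2) = a n"
      using word_inv_replicate_left[of n 0] by (simp add: a_0)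
    moreover have "word_inv (replicate n False) 1 = a (n - 1)"
      unfolding m by (simp only: word_inv_replicate_left_1 diff_Suc_1)
    ultimately have "J = {word_inv (replicate n False) (1/2)..<word_inv (replicate n False) 1}"
      by (simp only: n(2))
    then show ?thesis by blast
  qed
  then obtain n where Jn: "J = {word_inv (replicate n False) (1/2)..<word_inv (replicate n False) 1}"
    by blast
  have HJ: "H \<subseteq> J" unfolding HF J_def by (auto simp: \<P>_def)
  have J_sub: "J \<subseteq> {0..<1}" unfolding Jn by (rule word_inv_subset) auto
  have J_iff: "x \<in> J \<longleftrightarrow> itinerary n x = replicate n False \<and> 1/2 \<le> (T ^^ n) x"
    if "x \<in> {0..<1}" for x
    unfolding Jn using word_inv_mem_iff[OF that, of "1/2" 1 "replicate n False"] T_pow_range[OF that, of n]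
    by auto
  \<comment> \<open>A common bound for the number \<open>l + 1\<close> of letters used by the pulled back partitions and the
    number \<open>n + 1\<close> used by \<open>J\<close>.\<close>
  define M where "M = Suc (l + n)"
  have digit: "1/2 \<le> (T ^^ i) x \<longleftrightarrow> 1/2 \<le> (T ^^ i) x0"
    if "itinerary M x = itinerary M x0" "i < M" for x i
    using arg_cong[OF that(1), of "\<lambda>w. w ! i"] that(2) by (simp add: itinerary_def)
  show ?thesis
  proof (rule that[of "itinerary M x0" n])
    fix x assume x: "x \<in> {0..<1}" "itinerary (length (itinerary M x0)) x = itinerary M x0"
    then have it: "itinerary M x = itinerary M x0" by simp
    have x0_01: "x0 \<in> {0..<1}" using x0 HJ J_sub by blast
    have "itinerary n x = itinerary n x0"
      using digit[OF it] unfolding itinerary_def by (intro map_cong) (auto simp: M_def)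
    moreover have "1/2 \<le> (T ^^ n) x \<longleftrightarrow> 1/2 \<le> (T ^^ n) x0"
      by (rule digit[OF it]) (simp add: M_def)
    ultimately have "x \<in> J" using J_iff[OF x(1)] J_iff[OF x0_01] x0 HJ by auto
    moreover have "x \<in> F (pullback_part \<gamma> i part_P)" if "i \<le> l" for i
    proof -
      have "F (pullback_part \<gamma> i part_P) \<in> pullback_part \<gamma> i part_P"
        by (rule F) (use that in \<open>auto simp: \<P>_def\<close>)
      then obtain A where A: "A \<in> part_P" "F (pullback_part \<gamma> i part_P) = (T ^^ i) -` A \<inter> space_I"
        by (auto simp: pullback_part_def)
      have "x0 \<in> F (pullback_part \<gamma> i part_P)" using x0 that unfolding HF by (auto simp: \<P>_def)
      then have "(T ^^ i) x0 \<in> A" by (simp add: A(2))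
      moreover have "1/2 \<le> (T ^^ i) x \<longleftrightarrow> 1/2 \<le> (T ^^ i) x0"
        by (rule digit[OF it]) (use that in \<open>simp add: M_def\<close>)
      ultimately have "(T ^^ i) x \<in> A"
        using A(1) T_pow_range[OF x(1), of i] T_pow_range[OF x0_01, of i] by (auto simp: part_P_def)
      then show ?thesis using x(1) by (simp add: A(2))
    qed
    ultimately show "x \<in> H" unfolding HF by (auto simp: \<P>_def J_def)
  next
    fix x assume "x \<in> H"
    then show "a n \<le> x"
      using HJ word_inv_replicate_left[of n 0] by (auto simp: Jn a_0)
  next
    have "finite \<P>" "\<P> \<noteq> {}" by (auto simp: \<P>_def)
    moreover have "F P \<in> sets borel" if "P \<in> \<P>" for P
    proof -
      have "S \<in> sets borel" if "S \<in> part_J \<gamma>" for S using that by (auto simp: part_J_def)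
      moreover have "S \<in> sets borel" if S: "S \<in> pullback_part \<gamma> i part_P" for S i
      proof -
        obtain A where A: "A \<in> part_P" "S = (T ^^ i) -` A \<inter> space_I"
          using S by (auto simp: pullback_part_def)
        have "A \<in> sets borel" using A(1) by (auto simp: part_P_def)
        then have "(T ^^ i) -` A \<inter> space borel \<in> sets borel"
          by (rule measurable_sets[OF T_pow_measurable])
        then show ?thesis unfolding A(2) by auto
      qed
      ultimately show ?thesis using F[OF that] that by (auto simp: \<P>_def)
    qed
    ultimately show "H \<in> sets borel"
      unfolding HF by (intro sets.finite_INT) auto
  qed
qed

lemma survivors_iff: "x \<in> survivors \<gamma> H t \<longleftrightarrow> x \<in> {0..<1} \<and> (\<forall>i\<le>t. (T ^^ i) x \<notin> H)"
  using T_pow_range[of x] by (force simp: survivors_def)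

lemma survivors_measurable:
  assumes "H \<in> sets borel" shows "survivors \<gamma> H t \<in> sets borel"
proof -
  have "(T ^^ i) -` (space_I - H) \<inter> space borel \<in> sets borel" for i
    using assms by (intro measurable_sets[OF T_pow_measurable]) auto
  then show ?thesis unfolding survivors_def by (intro sets.finite_INT) auto
qed

text \<open>
  Avoiding the longer word \<open>False # w\<close> is a weaker condition than avoiding \<open>w\<close>, but this word has
  its cylinder inside \<open>[0, 1/2)\<close>, as needed in \<open>visits_summable\<close>. An orbit in this cylinder is in
  the hole one step later.
\<close>
lemma survivors_itinerary_avoids:
  assumes w: "\<And>x. x \<in> {0..<1} \<Longrightarrow> itinerary (length w) x = w \<Longrightarrow> x \<in> H"
    and x: "x \<in> survivors \<gamma> H t"
  shows "itinerary t x \<in> avoiding (False # w)"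
proof
  show "\<not> sublist (False # w) (itinerary t x)"
  proof
    assume "sublist (False # w) (itinerary t x)"
    then obtain p s where ps: "itinerary t x = p @ (False # w) @ s" by (auto simp: sublist_def)
    define i where "i = length p"
    have x01: "x \<in> {0..<1}" using x by (simp add: survivors_iff)
    have t: "t = i + (Suc (length w) + length s)"
      using arg_cong[OF ps, of length] by (simp add: i_def)
    have "itinerary i x @ itinerary (Suc (length w)) ((T ^^ i) x)
        @ itinerary (length s) ((T ^^ Suc (length w)) ((T ^^ i) x)) = p @ (False # w) @ s"
      using ps unfolding t by (simp only: itinerary_add)
    then have "itinerary (Suc (length w)) ((T ^^ i) x)
        @ itinerary (length s) ((T ^^ Suc (length w)) ((T ^^ i) x)) = (False # w) @ s"
      by (simp add: i_def)
    then have "itinerary (Suc (length w)) ((T ^^ i) x) = False # w"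
      by (subst (asm) append_eq_append_conv) simp_all
    then have "itinerary (length w) ((T ^^ Suc i) x) = w" by (simp add: itinerary_Suc)
    then have "(T ^^ Suc i) x \<in> H" by (rule w[OF T_pow_range[OF x01]])
    moreover have "Suc i \<le> t" by (simp add: t)
    ultimately show False using x by (auto simp: survivors_iff simp del: funpow.simps)
  qed
qed

text \<open>
  Within \<open>t\<close> steps such an orbit cannot climb to \<open>a N\<close>, below which there is no hole.
\<close>
lemma near_0_survives:
  assumes H: "\<And>x. x \<in> H \<Longrightarrow> a N \<le> x" and x: "0 \<le> x" "x < a (t + N)"
  shows "x \<in> survivors \<gamma> H t"
  unfolding survivors_iff
proof (intro conjI allI impI)
  show x01: "x \<in> {0..<1}" using x a_le_half[of "t + N"] by auto
  fix i assume "i \<le> t"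
  then have "x \<in> {word_inv (replicate i False) 0..<word_inv (replicate i False) (a (t - i + N))}"
    using x by (simp add: word_inv_replicate_left_0 word_inv_replicate_left)
  then have "(T ^^ i) x < a (t - i + N)"
    using word_inv_mem_iff[OF x01, of 0 "a (t - i + N)" "replicate i False"]
      a_pos[of "t - i + N"] a_le_1[of "t - i + N"] by auto
  also have "\<dots> \<le> a N" by (intro a_antimono) simp
  finally show "(T ^^ i) x \<notin> H" using H by force
qed

section \<open>Densities with a power singularity at 0\<close>

lemma sets_mu_dens: "sets (mu_dens f) = sets (restrict_space borel space_I)"
  by (simp add: mu_dens_def leb_I_def cong: sets_restrict_space_cong)

lemma space_mu_dens: "space (mu_dens f) = space_I"
  by (simp add: mu_dens_def leb_I_def space_restrict_space)

lemma emeasure_mu_dens: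
  assumes f: "integrable leb_I f" and A: "A \<in> sets borel" "A \<subseteq> {0..<1}"
  shows "emeasure (mu_dens f) A = (\<integral>\<^sup>+x. ennreal (f x) * indicator A x \<partial>lborel)"
proof -
  have "A \<in> sets leb_I" using A by (auto simp: leb_I_def sets_restrict_space_iff)
  then have "emeasure (mu_dens f) A = (\<integral>\<^sup>+x. ennreal (f x) * indicator A x \<partial>leb_I)"
    unfolding mu_dens_def using f by (subst emeasure_density) auto
  also have "\<dots> = (\<integral>\<^sup>+x. ennreal (f x) * indicator A x * indicator space_I x \<partial>lborel)"
    unfolding leb_I_def by (subst nn_integral_restrict_space) auto
  also have "\<dots> = (\<integral>\<^sup>+x. ennreal (f x) * indicator A x \<partial>lborel)"
    using A(2) by (intro nn_integral_cong) (auto split: split_indicator)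
  finally show ?thesis .
qed

lemma finite_measure_mu_dens:
  assumes f: "integrable leb_I f" shows "finite_measure (mu_dens f)"
proof (rule finite_measureI)
  have "emeasure (mu_dens f) (space (mu_dens f)) = (\<integral>\<^sup>+x. ennreal (f x) \<partial>leb_I)"
    unfolding mu_dens_def using f by (subst emeasure_density) (auto intro!: nn_integral_cong)
  also have "\<dots> \<le> (\<integral>\<^sup>+x. ennreal (norm (f x)) \<partial>leb_I)"
    by (intro nn_integral_mono ennreal_leI) auto
  also have "\<dots> < \<infinity>" using f by (simp add: integrable_iff_bounded)
  finally show "emeasure (mu_dens f) (space (mu_dens f)) \<noteq> \<infinity>" by simp
qed

lemma mu_dens_interval_upper:
  assumes f: "integrable leb_I f"
    and \<alpha>: "0 \<le> \<alpha>" "\<alpha> < 1" and C: "\<And>x. 0 < x \<Longrightarrow> x < 1 \<Longrightarrow> x powr \<alpha> * f x \<le> C" "0 \<le> C"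
    and uv: "0 < u" "u \<le> v" "v \<le> 1"
  shows "measure (mu_dens f) {u..<v} \<le> C * (v powr (1 - \<alpha>) / (1 - \<alpha>) - u powr (1 - \<alpha>) / (1 - \<alpha>))"
proof -
  have sub: "{u..<v} \<subseteq> {0..<1}" using uv by auto
  have pt: "f x \<le> C * x powr - \<alpha>" if "u \<le> x" "x < v" for x
  proof -
    have "0 < x" "x < 1" using that uv by auto
    then show ?thesis using C(1)[of x] by (simp add: powr_minus field_simps)
  qed
  have "emeasure (mu_dens f) {u..<v} = (\<integral>\<^sup>+x. ennreal (f x) * indicator {u..<v} x \<partial>lborel)"
    using emeasure_mu_dens[OF f _ sub] by simp
  also have "\<dots> \<le> (\<integral>\<^sup>+x. ennreal (C * x powr - \<alpha>) * indicator {u..v} x \<partial>lborel)"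
    by (intro nn_integral_mono) (auto simp: ennreal_leI pt split: split_indicator)
  also have "\<dots> = ennreal (C * (v powr (1 - \<alpha>) / (1 - \<alpha>)) - C * (u powr (1 - \<alpha>) / (1 - \<alpha>)))"
  proof (rule nn_integral_FTC_Icc)
    fix x assume "x \<in> {u..v}"
    then have "0 < x" using uv by auto
    then show "((\<lambda>x. C * (x powr (1 - \<alpha>) / (1 - \<alpha>))) has_real_derivative C * x powr - \<alpha>) (at x)"
      using \<alpha> by (auto intro!: derivative_eq_intros simp: divide_simps)
  qed (use C uv in auto)
  finally have "emeasure (mu_dens f) {u..<v}
      \<le> ennreal (C * (v powr (1 - \<alpha>) / (1 - \<alpha>)) - C * (u powr (1 - \<alpha>) / (1 - \<alpha>)))" .
  moreover have "C * (u powr (1 - \<alpha>) / (1 - \<alpha>)) \<le> C * (v powr (1 - \<alpha>) / (1 - \<alpha>))"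
    using C \<alpha> uv by (intro mult_left_mono divide_right_mono powr_mono2) auto
  ultimately have "measure (mu_dens f) {u..<v}
      \<le> C * (v powr (1 - \<alpha>) / (1 - \<alpha>)) - C * (u powr (1 - \<alpha>) / (1 - \<alpha>))"
    unfolding measure_def by (intro enn2real_leI) auto
  then show ?thesis by (simp add: right_diff_distrib)
qed

lemma mu_dens_interval_lower:
  assumes f: "integrable leb_I f"
    and \<alpha>: "0 \<le> \<alpha>" and c: "\<And>x. 0 < x \<Longrightarrow> x < x0 \<Longrightarrow> c \<le> x powr \<alpha> * f x" "0 \<le> c" and "x0 \<le> 1"
    and b: "0 < b" "b \<le> x0"
  shows "c * b powr (1 - \<alpha>) \<le> measure (mu_dens f) {0<..<b}"
proof -
  interpret finite_measure "mu_dens f" using finite_measure_mu_dens[OF f] by simp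
  have sub: "{0<..<b} \<subseteq> {0..<1}" using b \<open>x0 \<le> 1\<close> by auto
  have pt: "c * b powr - \<alpha> \<le> f x" if "0 < x" "x < b" for x
  proof -
    have "b powr - \<alpha> \<le> x powr - \<alpha>" using that \<alpha> by (intro powr_mono2') auto
    then have "c * b powr - \<alpha> \<le> c * x powr - \<alpha>" using c(2) by (rule mult_left_mono)
    also have "\<dots> \<le> f x" using c(1)[of x] that b by (simp add: powr_minus field_simps)
    finally show ?thesis .
  qed
  have "ennreal (c * b powr (1 - \<alpha>)) = ennreal (c * b powr - \<alpha>) * ennreal b"
    using b c(2) by (simp add: ennreal_mult[symmetric] powr_diff powr_minus field_simps)
  also have "\<dots> = (\<integral>\<^sup>+x. ennreal (c * b powr - \<alpha>) * indicator {0<..<b} x \<partial>lborel)"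
    using b by (subst nn_integral_cmult_indicator) auto
  also have "\<dots> \<le> (\<integral>\<^sup>+x. ennreal (f x) * indicator {0<..<b} x \<partial>lborel)"
    by (intro nn_integral_mono) (auto simp: ennreal_leI pt split: split_indicator)
  also have "\<dots> = emeasure (mu_dens f) {0<..<b}"
    using emeasure_mu_dens[OF f _ sub] by simp
  also have "\<dots> = ennreal (measure (mu_dens f) {0<..<b})" by (rule emeasure_eq_measure)
  finally show ?thesis by (simp add: ennreal_le_iff)
qed

end

section \<open>Convergence to the point mass\<close>

text \<open>
  Near \<open>0\<close> the test function is almost constant, and elsewhere it is bounded while the mass vanishes.
\<close>
lemma weak_conv_on_point_massI:
  assumes prob: "eventually (\<lambda>t. prob_space (M t)) sequentially"
    and sets: "\<And>t. sets (M t) = sets (restrict_space borel space_I)"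
    and lim: "\<And>\<epsilon>. 0 < \<epsilon> \<Longrightarrow> (\<lambda>t. measure (M t) {\<epsilon>..<1}) \<longlonglongrightarrow> 0"
  shows "weak_conv_on space_I M (return (restrict_space borel space_I) 0)"
  unfolding weak_conv_on_def
proof (intro allI impI)
  fix \<phi> :: "real \<Rightarrow> real"
  assume \<phi>: "continuous_on space_I \<phi> \<and> bounded (\<phi> ` space_I)"
  then obtain B where "0 < B" "\<forall>x\<in>space_I. \<bar>\<phi> x\<bar> \<le> B"
    by (auto simp: bounded_pos)
  then have B: "\<And>x. x \<in> space_I \<Longrightarrow> \<bar>\<phi> x\<bar> \<le> B" "0 < B" by blast+
  have meas: "\<phi> \<in> borel_measurable (restrict_space borel space_I)"
    using \<phi> by (intro borel_measurable_continuous_on_restrict) auto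
  have int0: "(\<integral>x. \<phi> x \<partial>return (restrict_space borel space_I) 0) = \<phi> 0"
    using meas by (intro integral_return) (auto simp: space_restrict_space)
  have "(\<lambda>t. \<integral>x. \<phi> x \<partial>M t) \<longlonglongrightarrow> \<phi> 0"
  proof (rule LIMSEQ_I)
    fix r :: real assume "0 < r"
    have "continuous (at 0 within space_I) \<phi>" using \<phi> by (simp add: continuous_on_eq_continuous_within)
    then obtain \<epsilon> where \<epsilon>: "0 < \<epsilon>" "\<And>x. x \<in> space_I \<Longrightarrow> dist x 0 < \<epsilon> \<Longrightarrow> dist (\<phi> x) (\<phi> 0) < r / 2"
      using \<open>0 < r\<close> unfolding continuous_within_eps_delta by (metis half_gt_zero)
    have "eventually (\<lambda>t. measure (M t) {\<epsilon>..<1} < r / (4 * B)) sequentially"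
      using lim[OF \<epsilon>(1)] \<open>0 < r\<close> \<open>0 < B\<close> by (intro order_tendstoD) auto
    with prob have "eventually (\<lambda>t. norm ((\<integral>x. \<phi> x \<partial>M t) - \<phi> 0) < r) sequentially"
    proof eventually_elim
      case (elim t)
      interpret prob_space "M t" by (rule elim)
      have sp: "space (M t) = space_I"
        using sets_eq_imp_space_eq[OF sets[of t]] by (simp add: space_restrict_space)
      have E: "{\<epsilon>..<1} \<in> sets (M t)"
        using \<epsilon>(1) by (subst sets) (auto simp: sets_restrict_space_iff)
      have mt: "\<phi> \<in> borel_measurable (M t)" using meas sets[of t] by (simp cong: measurable_cong_sets)
      have i1: "integrable (M t) \<phi>"
        using B mt by (intro integrable_const_bound[of _ B]) (auto simp: sp)
      have "(\<integral>x. \<phi> x \<partial>M t) - \<phi> 0 = (\<integral>x. \<phi> x - \<phi> 0 \<partial>M t)"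
        using i1 by (simp add: prob_space)
      then have "norm ((\<integral>x. \<phi> x \<partial>M t) - \<phi> 0) \<le> (\<integral>x. norm (\<phi> x - \<phi> 0) \<partial>M t)"
        by (simp only: integral_norm_bound)
      also have "\<dots> \<le> (\<integral>x. r / 2 + 2 * B * indicator {\<epsilon>..<1} x \<partial>M t)"
      proof (rule integral_mono)
        show "integrable (M t) (\<lambda>x. norm (\<phi> x - \<phi> 0))" using i1 by simp
        show "integrable (M t) (\<lambda>x. r / 2 + 2 * B * indicator {\<epsilon>..<1} x)" 
          using E by (intro Bochner_Integration.integrable_add integrable_const integrable_mult_right integrable_real_indicator)
            (auto simp: emeasure_eq_measure)
        fix x assume "x \<in> space (M t)"
        then have x: "x \<in> space_I" by (simp add: sp)
        show "norm (\<phi> x - \<phi> 0) \<le> r / 2 + 2 * B * indicator {\<epsilon>..<1} x"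
        proof (cases "x < \<epsilon>")
          case True
          then show ?thesis using \<epsilon>(2)[OF x] x by (simp add: dist_real_def)
        next
          case False
          have "\<bar>\<phi> x - \<phi> 0\<bar> \<le> 2 * B" using B(1)[OF x] B(1)[of 0] by simp
          then show ?thesis using False x \<open>0 < r\<close> by simp
        qed
      qed
      also have "\<dots> = r / 2 + 2 * B * measure (M t) {\<epsilon>..<1}"
        using E by (subst Bochner_Integration.integral_add) (auto simp: prob_space emeasure_eq_measure)
      also have "\<dots> < r / 2 + 2 * B * (r / (4 * B))"
        using elim(2) \<open>0 < B\<close> by (intro add_strict_left_mono mult_strict_left_mono) auto
      also have "\<dots> = r" using \<open>0 < B\<close> by (simp add: field_simps)
      finally show ?case .
    qed
    then show "\<exists>n0. \<forall>n\<ge>n0. norm ((\<integral>x. \<phi> x \<partial>M n) - \<phi> 0) < r"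
      by (simp add: eventually_sequentially)
  qed
  then show "(\<lambda>t. \<integral>x. \<phi> x \<partial>M t) \<longlonglongrightarrow> (\<integral>x. \<phi> x \<partial>return (restrict_space borel space_I) 0)"
    by (simp add: int0)
qed

context intermittent_map
begin

text \<open>
  The itineraries of survivors avoid \<open>False # w\<close>, where \<open>w\<close> is the word of a cylinder in the hole.
  Replacing \<open>f\<close> by \<open>C x\<^sup>-\<^sup>\<alpha>\<close>, concavity compares the mass in \<open>[a N, 1)\<close> word by word with the mass in the
  reference band, whose decay is known.
\<close>
lemma away_from_0_measure_decay:
  assumes H: "H \<in> part_Jt \<gamma> l"
    and f: "integrable leb_I f"
    and \<alpha>: "0 \<le> \<alpha>" "\<alpha> < 1" and C: "\<And>x. 0 < x \<Longrightarrow> x < 1 \<Longrightarrow> x powr \<alpha> * f x \<le> C" "0 \<le> C"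
  obtains B where "0 \<le> B" "\<And>t. measure (mu_dens f) {x \<in> survivors \<gamma> H t. a N \<le> (T ^^ t) x}
      \<le> B * (real t + 1) powr - (1 + (1 - \<alpha>) / \<gamma>)"
proof -
  interpret M: finite_measure "mu_dens f" using finite_measure_mu_dens[OF f] by simp
  obtain w where w: "\<And>x. x \<in> {0..<1} \<Longrightarrow> itinerary (length w) x = w \<Longrightarrow> x \<in> H"
    using hole_structure[OF H] by metis
  define v where "v = False # w"
  define \<kappa> where "\<kappa> = 1 + (1 - \<alpha>) / \<gamma>"
  have "\<kappa> > 1" using \<alpha> \<gamma>_pos by (simp add: \<kappa>_def)
  define \<Theta> where "\<Theta> x = x powr (1 - \<alpha>) / (1 - \<alpha>)" for x :: real
  have ic: "increasing_concave \<Theta>" unfolding \<Theta>_def using increasing_concave_powr[OF \<alpha>] by simp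
  obtain D where D: "0 \<le> D" "\<And>n. \<Theta> (a n) - \<Theta> (a (Suc n)) \<le> D * (real n + 1) powr - \<kappa>"
    unfolding \<Theta>_def \<kappa>_def using a_powr_gap_decay[OF \<alpha>] by blast
  obtain D' where D': "0 \<le> D'" "\<And>n. a n - a (Suc n) \<le> D' * (real n + 1) powr - (1 + 1 / \<gamma>)"
    using a_powr_gap_decay[of 0] a_pos by (auto simp: less_imp_le)
  have "a n - a (Suc n) \<le> D' * (real n + 1) powr - \<kappa>" for n
  proof -
    have "(real n + 1) powr - (1 + 1 / \<gamma>) \<le> (real n + 1) powr - \<kappa>"
      using \<alpha> \<gamma>_pos by (intro powr_mono) (auto simp: \<kappa>_def divide_right_mono)
    with D'(1) have "D' * (real n + 1) powr - (1 + 1 / \<gamma>) \<le> D' * (real n + 1) powr - \<kappa>"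
      by (intro mult_left_mono) auto
    with D'(2)[of n] show ?thesis by linarith
  qed
  then obtain E where E: "0 \<le> E" "\<And>n. band_sum \<Theta> N (avoiding v) n \<le> E * (real n + 1) powr - \<kappa>"
    using band_sum_avoiding_decay[OF v_def ic \<open>\<kappa> > 1\<close> D(1) D'(1) D(2)] by metis
  define k where "k = (1 - a N) / (a N - a (Suc N))"
  have k: "0 \<le> k" using a_Suc_less[of N] a_le_1[of N] by (simp add: k_def)
  show ?thesis
  proof (rule that[of "C * k * E"])
    show "0 \<le> C * k * E" using C k E by simp
    fix t
    define W where "W = {u \<in> avoiding v. length u = t}"
    have ar: "0 \<le> a N" "a N \<le> 1" using a_pos[of N] a_le_1[of N] by auto
    have "{x \<in> survivors \<gamma> H t. a N \<le> (T ^^ t) x}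
        \<subseteq> orbits (avoiding v) t (a N) 1"
    proof
      fix x assume x: "x \<in> {x \<in> survivors \<gamma> H t. a N \<le> (T ^^ t) x}"
      then have "x \<in> {0..<1}" by (simp add: survivors_iff)
      with x show "x \<in> orbits (avoiding v) t (a N) 1"
        using survivors_itinerary_avoids[OF w, where x = x and t = t] T_pow_range[of x t] by (auto simp: v_def)
    qed
    also have "\<dots> = (\<Union>u\<in>W. {word_inv u (a N)..<word_inv u 1})"
      unfolding W_def using ar by (intro cylinder_Union) auto
    finally have sub: "{x \<in> survivors \<gamma> H t. a N \<le> (T ^^ t) x}
        \<subseteq> (\<Union>u\<in>W. {word_inv u (a N)..<word_inv u 1})" .
    have in_sets: "{word_inv u (a N)..<word_inv u 1} \<in> sets (mu_dens f)" for u
      using word_inv_subset[of "a N" 1 u] ar sets_mu_dens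
      by (simp add: sets_restrict_space_iff)
    have "measure (mu_dens f) {x \<in> survivors \<gamma> H t. a N \<le> (T ^^ t) x}
        \<le> measure (mu_dens f) (\<Union>u\<in>W. {word_inv u (a N)..<word_inv u 1})"
      using sub in_sets by (intro M.finite_measure_mono sets.finite_UN) (auto simp: W_def finite_words[of "avoiding v", simplified])
    also have "\<dots> \<le> (\<Sum>u\<in>W. measure (mu_dens f) {word_inv u (a N)..<word_inv u 1})"
      using in_sets unfolding W_def by (intro M.finite_measure_subadditive_finite finite_words) auto
    also have "\<dots> \<le> (\<Sum>u\<in>W. C * k * band \<Theta> N u)"
    proof (rule sum_mono)
      fix u
      have "measure (mu_dens f) {word_inv u (a N)..<word_inv u 1} \<le> C * (\<Theta> (word_inv u 1) - \<Theta> (word_inv u (a N)))"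
        unfolding \<Theta>_def
        using a_pos[of N] a_le_1[of N] word_inv_pos[of "a N" u] word_inv_le[of "a N" 1 u] word_inv_range[of 1 u]
        by (intro mu_dens_interval_upper[OF f \<alpha> C]) auto
      also have "\<dots> \<le> C * (k * band \<Theta> N u)"
        unfolding k_def band_def using a_pos[of "Suc N"] a_Suc_less[of N] a_le_1[of N] C(2)
        by (intro mult_left_mono increasing_concave_slope[OF increasing_concave_word_inv[OF ic]]) auto
      finally show "measure (mu_dens f) {word_inv u (a N)..<word_inv u 1} \<le> C * k * band \<Theta> N u" by simp
    qed
    also have "\<dots> = C * k * band_sum \<Theta> N (avoiding v) t"
      by (simp add: band_sum_def W_def sum_distrib_left)
    also have "\<dots> \<le> C * k * (E * (real t + 1) powr - \<kappa>)"
      using C k E by (intro mult_left_mono) auto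
    finally show "measure (mu_dens f) {x \<in> survivors \<gamma> H t. a N \<le> (T ^^ t) x}
        \<le> C * k * E * (real t + 1) powr - (1 + (1 - \<alpha>) / \<gamma>)" by (simp add: \<kappa>_def)
  qed
qed

text \<open>
  Only the survivors in \<open>(0, a (t + N))\<close> are counted; near \<open>0\<close> the density is at least \<open>c x\<^sup>-\<^sup>\<alpha>\<close>.
\<close>
lemma survivors_measure_lower_bound:
  assumes H: "H \<in> part_Jt \<gamma> l"
    and f: "integrable leb_I f"
    and \<alpha>: "0 \<le> \<alpha>" "\<alpha> < 1" and c: "\<And>x. 0 < x \<Longrightarrow> x < x0 \<Longrightarrow> c \<le> x powr \<alpha> * f x" "0 < c"
    and x0: "0 < x0" "x0 \<le> 1"
  obtains b where "0 < b"
    "eventually (\<lambda>t. b * (real t + 1) powr - ((1 - \<alpha>) / \<gamma>) \<le> measure (mu_dens f) (survivors \<gamma> H t)) sequentially"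
proof -
  interpret M: finite_measure "mu_dens f" using finite_measure_mu_dens[OF f] by simp
  obtain N where N: "\<And>x. x \<in> H \<Longrightarrow> a N \<le> x" and Hb: "H \<in> sets borel"
    using hole_structure[OF H] by metis
  obtain d where d: "0 < d" "\<And>n. d * (real n + 1) powr - (1 / \<gamma>) \<le> a n"
    by (metis a_polynomial_bounds)
  define K where "K = d * (real N + 1) powr - (1 / \<gamma>)"
  have "K > 0" using d by (simp add: K_def)
  have aK: "K * (real t + 1) powr - (1 / \<gamma>) \<le> a (t + N)" for t
  proof -
    have "real (t + N) + 1 \<le> (real N + 1) * (real t + 1)" by (simp add: algebra_simps)
    then have "((real N + 1) * (real t + 1)) powr - (1 / \<gamma>) \<le> (real (t + N) + 1) powr - (1 / \<gamma>)"
      using \<gamma>_pos by (intro powr_mono2') auto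
    then have "d * ((real N + 1) * (real t + 1)) powr - (1 / \<gamma>) \<le> d * (real (t + N) + 1) powr - (1 / \<gamma>)"
      using d(1) by (intro mult_left_mono) auto
    with d(2)[of "t + N"] show ?thesis by (simp add: K_def powr_mult mult_ac)
  qed
  have "(\<lambda>t. a (t + N)) \<longlonglongrightarrow> 0" using a_tendsto_0 by (rule LIMSEQ_ignore_initial_segment)
  then have ev: "eventually (\<lambda>t. a (t + N) < x0) sequentially" using x0 by (intro order_tendstoD) auto
  show ?thesis
  proof (rule that[of "c * K powr (1 - \<alpha>)"])
    show "0 < c * K powr (1 - \<alpha>)" using c \<open>K > 0\<close> by simp
    show "eventually (\<lambda>t. c * K powr (1 - \<alpha>) * (real t + 1) powr - ((1 - \<alpha>) / \<gamma>)
        \<le> measure (mu_dens f) (survivors \<gamma> H t)) sequentially"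
      using ev
    proof eventually_elim
      case (elim t)
      have "c * K powr (1 - \<alpha>) * (real t + 1) powr - ((1 - \<alpha>) / \<gamma>)
          = c * (K * (real t + 1) powr - (1 / \<gamma>)) powr (1 - \<alpha>)"
        using \<open>K > 0\<close> by (simp add: powr_mult powr_powr)
      also have "\<dots> \<le> c * a (t + N) powr (1 - \<alpha>)"
        using aK[of t] \<alpha> c \<open>K > 0\<close> by (intro mult_left_mono powr_mono2) auto
      also have "\<dots> \<le> measure (mu_dens f) {0<..<a (t + N)}"
        using c(2) elim a_pos[of "t + N"] x0 by (intro mu_dens_interval_lower[OF f \<alpha>(1) c(1)]) auto
      also have "\<dots> \<le> measure (mu_dens f) (survivors \<gamma> H t)"
      proof (rule M.finite_measure_mono)
        show "{0<..<a (t + N)} \<subseteq> survivors \<gamma> H t" using near_0_survives[OF N, where t = t] by auto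
        show "survivors \<gamma> H t \<in> sets (mu_dens f)"
          unfolding sets_mu_dens using survivors_measurable[OF Hb]
          by (auto simp: sets_restrict_space_iff survivors_iff)
      qed
      finally show ?case .
    qed
  qed
qed

end

theorem theorem2p2:
  fixes \<gamma> p :: real and l\<^sub>H :: nat and H :: "real set" and f :: "real \<Rightarrow> real"
  assumes "0 < \<gamma>" and "\<gamma> < 1"
    and "H \<in> part_Jt \<gamma> l\<^sub>H"
    and "p > 0"
    and "f \<in> F0_class \<gamma> l\<^sub>H p"
  shows "weak_conv_on space_I
           (\<lambda>t. scale_measure (1 / emeasure (mu_dens f) (survivors \<gamma> H t))
                  (open_push \<gamma> H t (mu_dens f)))
           (return (restrict_space borel space_I) 0)
         \<and> (\<lambda>t. measure (mu_dens f) (survivors \<gamma> H (t + 1))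
                / measure (mu_dens f) (survivors \<gamma> H t)) \<longlonglongrightarrow> 1"
proof -
  interpret intermittent_map \<gamma> by unfold_locales (rule assms)
  define M where "M = mu_dens f"
  define S where "S = survivors \<gamma> H"
  define R where "R N t = {x \<in> S t. a N \<le> (T ^^ t) x}" for N t
  have f: "integrable leb_I f" and f_nonneg: "\<And>x. 0 < x \<Longrightarrow> x < 1 \<Longrightarrow> 0 \<le> f x"
    using assms(5) by (auto simp: F0_class_def F_class_def)
  obtain x0 \<alpha> where x0: "0 < x0" "x0 < 1" and \<alpha>: "0 \<le> \<alpha>" "\<alpha> < 1"
    and INF: "0 < (INF x\<in>{0<..<x0}. ereal (x powr \<alpha> * f x))"
    and SUP: "(SUP x\<in>{0<..<1}. ereal (x powr \<alpha> * f x)) < \<infinity>"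
    using assms(5) by (auto simp: F0_class_def)
  obtain c where c: "0 < c" "\<And>x. 0 < x \<Longrightarrow> x < x0 \<Longrightarrow> c \<le> x powr \<alpha> * f x"
  proof -
    obtain c where c: "0 < ereal c" "ereal c < (INF x\<in>{0<..<x0}. ereal (x powr \<alpha> * f x))"
      using ereal_dense2[OF INF] by blast
    have "c \<le> x powr \<alpha> * f x" if "0 < x" "x < x0" for x
    proof -
      have "ereal c \<le> ereal (x powr \<alpha> * f x)"
        using less_imp_le[OF c(2)] that by (auto simp: le_INF_iff simp del: ereal_less_eq)
      then show ?thesis by simp
    qed
    with c(1) show ?thesis using that by auto
  qed
  obtain C where C: "0 \<le> C" "\<And>x. 0 < x \<Longrightarrow> x < 1 \<Longrightarrow> x powr \<alpha> * f x \<le> C"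
  proof -
    obtain C where C: "(SUP x\<in>{0<..<1}. ereal (x powr \<alpha> * f x)) < ereal C"
      using ereal_dense2[OF SUP] by blast
    have C2: "x powr \<alpha> * f x \<le> C" if "0 < x" "x < 1" for x
    proof -
      have "ereal (x powr \<alpha> * f x) \<le> ereal C"
        using less_imp_le[OF C] that by (auto simp: SUP_le_iff simp del: ereal_less_eq)
      then show ?thesis by simp
    qed
    have "0 \<le> (1/2) powr \<alpha> * f (1/2)" using f_nonneg[of "1/2"] by simp
    also have "\<dots> \<le> C" by (rule C2) auto
    finally show ?thesis using that C2 by blast
  qed
  interpret M: finite_measure M unfolding M_def by (rule finite_measure_mu_dens[OF f])
  have sets_M: "sets M = sets (restrict_space borel space_I)" and space_M: "space M = space_I"
    unfolding M_def by (rule sets_mu_dens space_mu_dens)+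
  obtain N\<^sub>H where N\<^sub>H: "\<And>x. x \<in> H \<Longrightarrow> a N\<^sub>H \<le> x" and Hb: "H \<in> sets borel"
    using hole_structure[OF assms(3)] by metis
  have S_sets: "S t \<in> sets M" for t
    unfolding S_def sets_M using survivors_measurable[OF Hb]
    by (auto simp: sets_restrict_space_iff survivors_iff)
  have S_pull: "{x \<in> S t. (T ^^ s) x \<in> A} \<in> sets M" if "A \<in> sets borel" for A s t
  proof -
    have "(T ^^ s) -` A \<inter> space borel \<in> sets borel"
      using that by (rule measurable_sets[OF T_pow_measurable])
    moreover have "S t \<in> sets borel" unfolding S_def by (rule survivors_measurable[OF Hb])
    ultimately have "S t \<inter> (T ^^ s) -` A \<in> sets borel" by auto
    moreover have "{x \<in> S t. (T ^^ s) x \<in> A} = S t \<inter> (T ^^ s) -` A" by auto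
    ultimately show ?thesis
      unfolding sets_M by (auto simp: sets_restrict_space_iff S_def survivors_iff)
  qed
  obtain b where b: "0 < b"
    "eventually (\<lambda>t. b * (real t + 1) powr - ((1 - \<alpha>) / \<gamma>) \<le> measure M (S t)) sequentially"
    using survivors_measure_lower_bound[OF assms(3) f \<alpha> c(2) c(1) x0(1) less_imp_le[OF x0(2)]]
    unfolding M_def S_def by blast
  have S_pos: "eventually (\<lambda>t. 0 < measure M (S t)) sequentially"
    using b(2) by eventually_elim (use b(1) in \<open>auto intro: less_le_trans[rotated]\<close>)
  have R_lim: "(\<lambda>t. measure M (R N t) / measure M (S t)) \<longlonglongrightarrow> 0" for N
  proof -
    obtain B where B: "0 \<le> B" "\<And>t. measure M (R N t) \<le> B * (real t + 1) powr - (1 + (1 - \<alpha>) / \<gamma>)"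
      using away_from_0_measure_decay[OF assms(3) f \<alpha> C(2) C(1), of N] unfolding M_def R_def S_def by blast
    \<comment> \<open>The exponents of the two bounds differ by exactly \<open>1\<close>.\<close>
    have up: "eventually (\<lambda>t. measure M (R N t) / measure M (S t) \<le> B / b * inverse (real (Suc t))) sequentially"
      using b(2)
    proof eventually_elim
      case (elim t)
      have "measure M (R N t) / measure M (S t)
          \<le> (B * (real t + 1) powr - (1 + (1 - \<alpha>) / \<gamma>)) / (b * (real t + 1) powr - ((1 - \<alpha>) / \<gamma>))"
        using b(1) B elim by (intro frac_le) auto
      also have "(real t + 1) powr - (1 + (1 - \<alpha>) / \<gamma>)
          = (real t + 1) powr - ((1 - \<alpha>) / \<gamma>) * inverse (real t + 1)"
        by (simp add: powr_diff powr_minus field_simps)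
      also have "B * ((real t + 1) powr - ((1 - \<alpha>) / \<gamma>) * inverse (real t + 1))
          / (b * (real t + 1) powr - ((1 - \<alpha>) / \<gamma>)) = B / b * inverse (real (Suc t))"
      proof -
        have "B * (P * i) / (b * P) = B / b * i" if "P \<noteq> 0" for P i using that by simp
        from this[of "(real t + 1) powr - ((1 - \<alpha>) / \<gamma>)" "inverse (real t + 1)"]
        show ?thesis by (simp add: add.commute)
      qed
      finally show ?case .
    qed
    have "(\<lambda>t. B / b * inverse (real (Suc t))) \<longlonglongrightarrow> B / b * 0"
      by (intro tendsto_mult tendsto_const LIMSEQ_inverse_real_of_nat)
    then have "(\<lambda>t. B / b * inverse (real (Suc t))) \<longlonglongrightarrow> 0" by simp
    then show ?thesis by (rule tendsto_sandwich[OF _ up tendsto_const, rotated]) auto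
  qed
  show ?thesis
  proof
    define \<nu> where "\<nu> t = scale_measure (1 / emeasure M (S t)) (open_push \<gamma> H t M)" for t
    have push: "emeasure (open_push \<gamma> H t M) A = emeasure M {x \<in> S t. (T ^^ t) x \<in> A}"
      if "A \<in> sets (restrict_space borel space_I)" for A t
    proof -
      have "T ^^ t \<in> measurable (restrict_space M (S t)) (restrict_space borel space_I)"
      proof (rule measurable_restrict_space2)
        have "T ^^ t \<in> measurable (restrict_space borel space_I) borel"
          by (rule measurable_restrict_space1[OF T_pow_measurable])
        then have "T ^^ t \<in> measurable M borel" using sets_M by (simp cong: measurable_cong_sets)
        then show "T ^^ t \<in> measurable (restrict_space M (S t)) borel"
          by (rule measurable_restrict_space1)
        show "T ^^ t \<in> space (restrict_space M (S t)) \<rightarrow> space_I"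
          using T_pow_range by (auto simp: space_restrict_space S_def survivors_iff)
      qed
      then have "emeasure (open_push \<gamma> H t M) A
          = emeasure (restrict_space M (S t)) ((T ^^ t) -` A \<inter> space (restrict_space M (S t)))"
        unfolding open_push_def S_def[symmetric] using that by (rule emeasure_distr)
      also have "\<dots> = emeasure M ((T ^^ t) -` A \<inter> space (restrict_space M (S t)))"
        using S_sets[of t] by (intro emeasure_restrict_space) (auto simp: space_restrict_space)
      also have "(T ^^ t) -` A \<inter> space (restrict_space M (S t)) = {x \<in> S t. (T ^^ t) x \<in> A}"
        by (auto simp: space_restrict_space space_M S_def survivors_iff)
      finally show ?thesis .
    qed
    have \<nu>_sets: "sets (\<nu> t) = sets (restrict_space borel space_I)" for t
      by (simp add: \<nu>_def open_push_def)
    have \<nu>_space: "space (\<nu> t) = space_I" for t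
      using sets_eq_imp_space_eq[OF \<nu>_sets[of t]] by (simp add: space_restrict_space)
    have \<nu>_eq: "emeasure (\<nu> t) A = ennreal (measure M {x \<in> S t. (T ^^ t) x \<in> A} / measure M (S t))"
      if "A \<in> sets (restrict_space borel space_I)" "0 < measure M (S t)" for A t
      using that push[OF that(1), of t]
      by (simp add: \<nu>_def M.emeasure_eq_measure divide_ennreal ennreal_mult'[symmetric]
          flip: ennreal_1)
    have "eventually (\<lambda>t. prob_space (\<nu> t)) sequentially"
      using S_pos
    proof eventually_elim
      case (elim t)
      have "{x \<in> S t. (T ^^ t) x \<in> space_I} = S t"
        using T_pow_range by (auto simp: S_def survivors_iff simp del: atLeastLessThan_iff)
      then have "emeasure (\<nu> t) space_I = 1"
        using \<nu>_eq[of space_I t] elim by (simp add: sets_restrict_space_iff)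
      then show ?case by (intro prob_spaceI) (simp add: \<nu>_space)
    qed
    moreover have "(\<lambda>t. measure (\<nu> t) {\<epsilon>..<1}) \<longlonglongrightarrow> 0" if \<epsilon>: "0 < \<epsilon>" for \<epsilon>
    proof -
      obtain N where N: "a N < \<epsilon>"
        using order_tendstoD(2)[OF a_tendsto_0 \<epsilon>] unfolding eventually_sequentially by blast
      have E: "{\<epsilon>..<1} \<in> sets (restrict_space borel space_I)"
        using \<epsilon> by (simp add: sets_restrict_space_iff)
      have "eventually (\<lambda>t. measure (\<nu> t) {\<epsilon>..<1} \<le> measure M (R N t) / measure M (S t)) sequentially"
        using S_pos
      proof eventually_elim
        case (elim t)
        have "measure (\<nu> t) {\<epsilon>..<1} = measure M {x \<in> S t. (T ^^ t) x \<in> {\<epsilon>..<1}} / measure M (S t)"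
          unfolding measure_def[of "\<nu> t"] \<nu>_eq[OF E elim] by simp
        also have "\<dots> \<le> measure M (R N t) / measure M (S t)"
          using N S_pull[of "{a N..}" t t]
          by (intro divide_right_mono M.finite_measure_mono) (auto simp: R_def)
        finally show ?case .
      qed
      then show ?thesis by (rule tendsto_sandwich[OF _ _ tendsto_const R_lim[of N], rotated]) auto
    qed
    ultimately have "weak_conv_on space_I \<nu> (return (restrict_space borel space_I) 0)"
      using \<nu>_sets by (intro weak_conv_on_point_massI)
    then show "weak_conv_on space_I
       (\<lambda>t. scale_measure (1 / emeasure (mu_dens f) (survivors \<gamma> H t)) (open_push \<gamma> H t (mu_dens f)))
       (return (restrict_space borel space_I) 0)"
      by (simp add: \<nu>_def[abs_def] M_def S_def)
  next
    define r where "r t = measure M (S (t + 1)) / measure M (S t)" for t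
    \<comment> \<open>A point below \<open>a (Suc N\<^sub>H)\<close> is mapped below \<open>a N\<^sub>H\<close>, where there is no hole.\<close>
    define N where "N = Suc N\<^sub>H"
    have step: "S t - R N t \<subseteq> S (t + 1)" for t
    proof
      fix x assume x: "x \<in> S t - R N t"
      then have x01: "x \<in> {0..<1}" and y: "(T ^^ t) x < a N" by (auto simp: S_def R_def survivors_iff)
      have y0: "(T ^^ t) x \<in> {0..<1}" by (rule T_pow_range[OF x01])
      have "T ((T ^^ t) x) < a N\<^sub>H"
        using y y0 left_inv_compare(2)[of "(T ^^ t) x" "a N\<^sub>H"] a_le_half[of N] a_pos[of N\<^sub>H] a_le_1[of N\<^sub>H]
        by (auto simp: N_def a_Suc T_map_def)
      then have "(T ^^ Suc t) x \<notin> H" using N\<^sub>H by force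
      then show "x \<in> S (t + 1)" using x by (auto simp: S_def survivors_iff le_Suc_eq)
    qed
    have "eventually (\<lambda>t. 1 - measure M (R N t) / measure M (S t) \<le> r t \<and> r t \<le> 1) sequentially"
      using S_pos
    proof eventually_elim
      case (elim t)
      have R_sets: "R N t \<in> sets M" using S_pull[of "{a N..}" t t] by (simp add: R_def)
      have "measure M (S t) - measure M (R N t) = measure M (S t - R N t)"
        using R_sets S_sets by (intro M.finite_measure_Diff[symmetric]) (auto simp: R_def)
      also have "\<dots> \<le> measure M (S (t + 1))" by (rule M.finite_measure_mono[OF step S_sets])
      finally have "measure M (S t) - measure M (R N t) \<le> measure M (S (t + 1))" .
      moreover have "measure M (S (t + 1)) \<le> measure M (S t)"
        by (rule M.finite_measure_mono[OF _ S_sets]) (auto simp: S_def survivors_iff)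
      moreover have "1 - measure M (R N t) / measure M (S t)
          = (measure M (S t) - measure M (R N t)) / measure M (S t)"
        using elim by (simp add: diff_divide_distrib)
      ultimately show ?case using elim by (simp add: r_def divide_right_mono)
    qed
    then have lower: "eventually (\<lambda>t. 1 - measure M (R N t) / measure M (S t) \<le> r t) sequentially"
      and upper: "eventually (\<lambda>t. r t \<le> 1) sequentially"
      by (simp_all add: eventually_conj_iff)
    have "(\<lambda>t. 1 - measure M (R N t) / measure M (S t)) \<longlonglongrightarrow> 1 - 0"
      by (intro tendsto_intros R_lim)
    then have "r \<longlonglongrightarrow> 1"
      using tendsto_sandwich[OF lower upper _ tendsto_const] by simp
    then show "(\<lambda>t. measure (mu_dens f) (survivors \<gamma> H (t + 1)) / measure (mu_dens f) (survivors \<gamma> H t)) \<longlonglongrightarrow> 1"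
      by (simp add: r_def[abs_def] M_def S_def)
  qed
qed

end
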